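(* For every real $t_0\ge1$, the set $P\mathcal{C}_{t_0}\cup\{A^nx\mid n\in\mathbb{N},\ n<\log_{\rho_k}t_0\}$ is a subset of $\mathbb{R}^d$ definable in $\mathrm{Th}(\mathbb{R}_{\exp})$, and it is an invariant for $(A,x)$, i.e. it contains $x$ and is mapped into itself by $A$.
   Context: Setting: $A\in\mathbb{Q}^{d\times d}$ is invertible and $x\in\mathbb{Q}^d$. Write $A=PJP^{-1}$ with $P\in\mathbb{C}^{d\times d}$ invertible and $J=\mathrm{diag}(B_1,\dots,B_k)$ in Jordan normal form, where $B_i\in\mathbb{C}^{d_i\times d_i}$ is a Jordan block (eigenvalue on the diagonal, $1$ on the superdiagonal) with eigenvalue $\rho_i\lambda_i$, $\rho_i>0$ real, $\lambda_i\in\mathbb{C}$ with $|\lambda_i|=1$, $\sum_i d_i=d$. Coordinates of $\mathbb{C}^d$ are indexed by pairs $(i,j)$, $1\le i\le k$, $1\le j\le d_i$ (row $j$ of block $i$). It is assumed that $\rho_k>1$; put $b_i=\log_{\rho_k}\rho_i$. Let $x'=P^{-1}x$ and for real $s$ let $Q_{i,j}(s)=\sum_{c=0}^{d_i-j}\binom{s}{c}(\rho_i\lambda_i)^{-c}x'_{(i,j+c)}$, where $\binom{s}{c}=\frac{1}{c!}\prod_{r=0}^{c-1}(s-r)$. Let $G=\{v\in\mathbb{Z}^k\mid\lambda_1^{v_1}\cdots\lambda_k^{v_k}=1\}$ and $\mathbb{T}=\{(\alpha_1,\dots,\alpha_k)\in\mathbb{C}^k\mid |\alpha_i|=1\ \forall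 i,\ \alpha_1^{v_1}\cdots\alpha_k^{v_k}=1\ \forall v\in G\}$. For $p\in\mathbb{T}$ and $t_0\ge1$ the ray $\mathsf{r}(p,t_0)\subseteq\mathbb{C}^d$ is the set of vectors $y$, for $t\ge t_0$, whose $(i,j)$-coordinate is $t^{b_i}p_iQ_{i,j}(\log_{\rho_k}t)$; the trajectory cone is $\mathcal{C}_{t_0}=\bigcup_{p\in\mathbb{T}}\mathsf{r}(p,t_0)$. $\mathrm{Th}(\mathbb{R}_{\exp})$ is the first-order theory of $\langle\mathbb{R},0,1,+,\cdot,<,x\mapsto e^x\rangle$. *)

theory Defs
  imports Complex_Main "Jordan_Normal_Form.Jordan_Normal_Form"
begin

datatype exp_term =
    TVar nat
  | TZero
  | TOne
  | TAdd exp_term exp_term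
  | TMul exp_term exp_term
  | TExp exp_term

datatype exp_formula =
    FEq exp_term exp_term
  | FLess exp_term exp_term
  | FNot exp_formula
  | FAnd exp_formula exp_formula
  | FEx nat exp_formula

primrec term_val :: "(nat \<Rightarrow> real) \<Rightarrow> exp_term \<Rightarrow> real" where
  "term_val e (TVar n) = e n"
| "term_val e TZero = 0"
| "term_val e TOne = 1"
| "term_val e (TAdd s t) = term_val e s + term_val e t"
| "term_val e (TMul s t) = term_val e s * term_val e t"
| "term_val e (TExp t) = exp (term_val e t)"

primrec holds :: "(nat \<Rightarrow> real) \<Rightarrow> exp_formula \<Rightarrow> bool" where
  "holds e (FEq s t) \<longleftrightarrow> term_val e s = term_val e t"
| "holds e (FLess s t) \<longleftrightarrow> term_val e s < term_val e t"
| "holds e (FNot f) \<longleftrightarrow> \<not> holds e f"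
| "holds e (FAnd f g) \<longleftrightarrow> holds e f \<and> holds e g"
| "holds e (FEx n f) \<longleftrightarrow> (\<exists>a. holds (e(n := a)) f)"

primrec term_vars :: "exp_term \<Rightarrow> nat set" where
  "term_vars (TVar n) = {n}"
| "term_vars TZero = {}"
| "term_vars TOne = {}"
| "term_vars (TAdd s t) = term_vars s \<union> term_vars t"
| "term_vars (TMul s t) = term_vars s \<union> term_vars t"
| "term_vars (TExp t) = term_vars t"

primrec free_vars :: "exp_formula \<Rightarrow> nat set" where
  "free_vars (FEq s t) = term_vars s \<union> term_vars t"
| "free_vars (FLess s t) = term_vars s \<union> term_vars t"
| "free_vars (FNot f) = free_vars f"
| "free_vars (FAnd f g) = free_vars f \<union> free_vars g"
| "free_vars (FEx n f) = free_vars f - {n}"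

text \<open>
  Definability, with parameters from \<open>B\<close>, of a subset of the \<open>d\<close>-dimensional real space in the
  ordered exponential field of the reals: variables below \<open>d\<close> stand for the coordinates, the
  following ones for the parameters. For \<open>B = {}\<close> this is parameter-free definability.
\<close>

definition Rexp_definable :: "real set \<Rightarrow> nat \<Rightarrow> real vec set \<Rightarrow> bool" where
  "Rexp_definable B d S \<longleftrightarrow>
     (\<exists>f ps. set ps \<subseteq> B \<and> free_vars f \<subseteq> {..<d + length ps} \<and>
        S = {y \<in> carrier_vec d. holds (\<lambda>n. if n < d then y $ n else ps ! (n - d)) f})"

text \<open>
  Below, \<open>k\<close> is the number of Jordan blocks; block \<open>i < k\<close> has size \<open>ds i\<close> and eigenvalue
  \<open>rho i * lam i\<close>. Blocks and the rows inside a block are numbered from 0, so the last block is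
  \<open>k - 1\<close>.
\<close>

definition coord :: "(nat \<Rightarrow> nat) \<Rightarrow> nat \<Rightarrow> nat \<Rightarrow> nat" where
  "coord ds i j = (\<Sum>l<i. ds l) + j"

definition jordan_form ::
  "nat \<Rightarrow> (nat \<Rightarrow> nat) \<Rightarrow> (nat \<Rightarrow> real) \<Rightarrow> (nat \<Rightarrow> complex) \<Rightarrow> complex mat" where
  "jordan_form k ds rho lam =
     jordan_matrix (map (\<lambda>i. (ds i, complex_of_real (rho i) * lam i)) [0..<k])"

text \<open>
  With \<open>j\<close> numbered from 0, the summation range is \<open>c \<le> ds i - 1 - j\<close>, that is \<open>c < ds i - j\<close>.
\<close>

definition Qpoly ::
  "(nat \<Rightarrow> nat) \<Rightarrow> (nat \<Rightarrow> real) \<Rightarrow> (nat \<Rightarrow> complex) \<Rightarrow> complex vec \<Rightarrow> nat \<Rightarrow> nat \<Rightarrow> real \<Rightarrow> complex"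
where
  "Qpoly ds rho lam x' i j s =
     (\<Sum>c<ds i - j. complex_of_real (s gchoose c) *
        (complex_of_real (rho i) * lam i) powi (- int c) * x' $ coord ds i (j + c))"

definition mult_relations :: "nat \<Rightarrow> (nat \<Rightarrow> complex) \<Rightarrow> int vec set" where
  "mult_relations k lam = {v \<in> carrier_vec k. (\<Prod>i<k. lam i powi (v $ i)) = 1}"

definition torus :: "nat \<Rightarrow> (nat \<Rightarrow> complex) \<Rightarrow> complex vec set" where
  "torus k lam = {p \<in> carrier_vec k.
     (\<forall>i<k. cmod (p $ i) = 1) \<and> (\<forall>v\<in>mult_relations k lam. (\<Prod>i<k. (p $ i) powi (v $ i)) = 1)}"

definition ray ::
  "nat \<Rightarrow> (nat \<Rightarrow> nat) \<Rightarrow> (nat \<Rightarrow> real) \<Rightarrow> (nat \<Rightarrow> complex) \<Rightarrow> complex vec \<Rightarrow>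
   complex vec \<Rightarrow> real \<Rightarrow> complex vec set" where
  "ray k ds rho lam x' p t0 =
     {y \<in> carrier_vec (\<Sum>i<k. ds i). \<exists>t\<ge>t0. \<forall>i<k. \<forall>j<ds i.
        y $ coord ds i j =
          complex_of_real (t powr log (rho (k - 1)) (rho i)) * p $ i *
          Qpoly ds rho lam x' i j (log (rho (k - 1)) t)}"

definition trajectory_cone ::
  "nat \<Rightarrow> (nat \<Rightarrow> nat) \<Rightarrow> (nat \<Rightarrow> real) \<Rightarrow> (nat \<Rightarrow> complex) \<Rightarrow> complex vec \<Rightarrow> real \<Rightarrow> complex vec set"
where
  "trajectory_cone k ds rho lam x' t0 = (\<Union>p\<in>torus k lam. ray k ds rho lam x' p t0)"

definition is_invariant :: "'a :: semiring_0 mat \<Rightarrow> 'a vec \<Rightarrow> 'a vec set \<Rightarrow> bool" where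
  "is_invariant A x I \<longleftrightarrow> x \<in> I \<and> (\<lambda>y. A *\<^sub>v y) ` I \<subseteq> I"

end

theory Submission
  imports Defs
begin

text \<open>
  Entry \<open>u\<close> of the point \<open>P y\<close> of the cone with parameters \<open>p\<close>, \<open>t = \<rho>\<^sub>k\<^sup>s\<close> is the sum over the eigenvalues
  \<open>\<mu>\<close> of \<open>A\<close> and over \<open>m < d\<close> of \<open>\<bar>\<mu>\<bar>\<^sup>s p\<^sub>\<mu> (s choose m) \<mu>\<^sup>-\<^sup>m K\<^sub>u\<^sub>,\<^sub>\<mu>\<^sub>,\<^sub>m\<close>. The constants \<open>K\<close> are obtained by evaluating
  an explicit Hermite interpolation polynomial, whose coefficients are rational expressions in the
  eigenvalues, at \<open>A\<close> and applying the result to \<open>x\<close>. So the \<open>K\<close> are algebraic and hence definable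
  although \<open>P\<close> may have transcendental entries, and complex conjugation exchanges the summands of
  \<open>\<mu>\<close> and of its conjugate, so that the cone is real. The torus is cut out by finitely many of its
  relations since subgroups of the integer lattice are finitely generated. Applying \<open>A\<close> replaces
  \<open>(p, s)\<close> by \<open>(\<lambda> p, s + 1)\<close>, by Pascal's rule.
\<close>

subsection \<open>Definability over the ordered exponential field\<close>

text \<open>The only parameter allowed is \<open>t0\<close>, so every other constant of the formula
  must itself be shown definable. Single columns of \<open>P\<close> and single entries of
  \<open>x'\<close> depend on the chosen Jordan basis; only their combined contribution over all
  blocks with one eigenvalue is intrinsic. It can be recovered from rational data because the orbit
  obeys the same closed form as the cone: \<open>A^n x\<close> is the cone expression at
  \<open>p = lam^n\<close>, \<open>s = n\<close>. Combining orbit points with the coefficients of a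
  polynomial therefore yields its Taylor coefficients at the eigenvalues times the wanted constants,
  and interpolation isolates each constant. Grouping blocks by eigenvalue requires \<open>p\<close>
  to agree on blocks with equal eigenvalue, and reality requires conjugate values on conjugate
  eigenvalues. Both are relations between two entries of \<open>lam\<close>, hence hold on the whole
  torus. The parameter \<open>s = log t\<close> replaces \<open>t\<close> so that all real powers
  become \<open>exp (s * ln r)\<close> with a definable constant \<open>r\<close>.\<close>

lemma finite_term_vars: "finite (term_vars t)"
  by (induction t) auto

lemma finite_free_vars: "finite (free_vars f)"
  by (induction f) (auto simp: finite_term_vars)

lemma term_val_cong:
  "(\<And>n. n \<in> term_vars t \<Longrightarrow> e n = e' n) \<Longrightarrow> term_val e t = term_val e' t"
  by (induction t) auto

lemma holds_cong:
  "(\<And>n. n \<in> free_vars f \<Longrightarrow> e n = e' n) \<Longrightarrow> holds e f \<longleftrightarrow> holds e' f"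
proof (induction f arbitrary: e e')
  case (FEq s t)
  then show ?case using term_val_cong[of s e e'] term_val_cong[of t e e'] by auto
next
  case (FLess s t)
  then show ?case using term_val_cong[of s e e'] term_val_cong[of t e e'] by auto
next
  case (FNot f)
  then show ?case by (metis free_vars.simps(3) holds.simps(3))
next
  case (FAnd f g)
  have "holds e f \<longleftrightarrow> holds e' f" by (rule FAnd.IH(1)) (simp add: FAnd.prems)
  moreover have "holds e g \<longleftrightarrow> holds e' g" by (rule FAnd.IH(2)) (simp add: FAnd.prems)
  ultimately show ?case by simp
next
  case (FEx n f)
  have "holds (e(n := a)) f \<longleftrightarrow> holds (e'(n := a)) f" for a
    by (rule FEx.IH) (simp add: FEx.prems)
  then show ?case by simp
qed

section \<open>Renaming variables and quantifying over blocks of variables\<close>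

primrec rename_term :: "(nat \<Rightarrow> nat) \<Rightarrow> exp_term \<Rightarrow> exp_term" where
  "rename_term \<sigma> (TVar n) = TVar (\<sigma> n)"
| "rename_term \<sigma> TZero = TZero"
| "rename_term \<sigma> TOne = TOne"
| "rename_term \<sigma> (TAdd s t) = TAdd (rename_term \<sigma> s) (rename_term \<sigma> t)"
| "rename_term \<sigma> (TMul s t) = TMul (rename_term \<sigma> s) (rename_term \<sigma> t)"
| "rename_term \<sigma> (TExp t) = TExp (rename_term \<sigma> t)"

lemma term_val_rename: "term_val e (rename_term \<sigma> t) = term_val (\<lambda>n. e (\<sigma> n)) t"
  by (induction t) auto

text \<open>Bound variables must be chosen afresh for each \<open>\<sigma>\<close>, so the renamed
  formula is only asserted to exist. \<open>\<sigma>\<close> may identify variables, and later uses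
  rely on this.\<close>

lemma holds_rename: "\<exists>f'. \<forall>e. holds e f' \<longleftrightarrow> holds (\<lambda>n. e (\<sigma> n)) f"
proof (induction f arbitrary: \<sigma>)
  case (FEq s t)
  show ?case by (rule exI[of _ "FEq (rename_term \<sigma> s) (rename_term \<sigma> t)"]) (simp add: term_val_rename)
next
  case (FLess s t)
  show ?case by (rule exI[of _ "FLess (rename_term \<sigma> s) (rename_term \<sigma> t)"]) (simp add: term_val_rename)
next
  case (FNot f)
  then obtain f' where "\<forall>e. holds e f' \<longleftrightarrow> holds (\<lambda>n. e (\<sigma> n)) f" by blast
  then show ?case by (intro exI[of _ "FNot f'"]) simp
next
  case (FAnd f g)
  obtain f' where "\<forall>e. holds e f' \<longleftrightarrow> holds (\<lambda>n. e (\<sigma> n)) f" using FAnd.IH(1) by blast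
  moreover obtain g' where "\<forall>e. holds e g' \<longleftrightarrow> holds (\<lambda>n. e (\<sigma> n)) g" using FAnd.IH(2) by blast
  ultimately show ?case by (intro exI[of _ "FAnd f' g'"]) simp
next
  case (FEx n f)
  \<comment> \<open>A bound variable outside the image of the free variables cannot capture any of
    them.\<close>
  obtain n' where n': "n' \<notin> \<sigma> ` free_vars f"
    using ex_new_if_finite[OF infinite_UNIV_nat finite_imageI[OF finite_free_vars]] by blast
  obtain f' where f': "\<forall>e. holds e f' \<longleftrightarrow> holds (\<lambda>m. e ((\<sigma>(n := n')) m)) f" using FEx.IH by blast
  have "holds (e(n' := a)) f' \<longleftrightarrow> holds ((\<lambda>m. e (\<sigma> m))(n := a)) f" for e a
    unfolding f'[rule_format] by (rule holds_cong) (use n' in auto)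
  then show ?case by (intro exI[of _ "FEx n' f'"]) simp
qed

lemma holds_Ex_set:
  assumes "finite V"
  shows "\<exists>f'. free_vars f' = free_vars f - V \<and>
           (\<forall>e. holds e f' \<longleftrightarrow> (\<exists>a. holds (\<lambda>n. if n \<in> V then a n else e n) f))"
  using assms
proof (induction V)
  case empty
  show ?case by (rule exI[of _ f]) simp
next
  case (insert v V)
  then obtain f' where f': "free_vars f' = free_vars f - V"
      "\<And>e. holds e f' \<longleftrightarrow> (\<exists>a. holds (\<lambda>n. if n \<in> V then a n else e n) f)" by blast
  have "(\<exists>b. holds (e(v := b)) f') \<longleftrightarrow>
        (\<exists>a. holds (\<lambda>n. if n \<in> insert v V then a n else e n) f)" for e
  proof
    assume "\<exists>b. holds (e(v := b)) f'"
    then obtain b a where "holds (\<lambda>n. if n \<in> V then a n else (e(v := b)) n) f"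
      unfolding f' by blast
    also have "(\<lambda>n. if n \<in> V then a n else (e(v := b)) n) =
        (\<lambda>n. if n \<in> insert v V then (if n \<in> V then a n else b) else e n)" by auto
    finally show "\<exists>a. holds (\<lambda>n. if n \<in> insert v V then a n else e n) f"
      by (rule exI[of _ "\<lambda>n. if n \<in> V then a n else b"])
  next
    assume "\<exists>a. holds (\<lambda>n. if n \<in> insert v V then a n else e n) f"
    then obtain a where "holds (\<lambda>n. if n \<in> insert v V then a n else e n) f" by blast
    also have "(\<lambda>n. if n \<in> insert v V then a n else e n) =
        (\<lambda>n. if n \<in> V then a n else (e(v := a v)) n)" by auto
    finally show "\<exists>b. holds (e(v := b)) f'" unfolding f' by blast
  qed
  then show ?case by (intro exI[of _ "FEx v f'"]) (auto simp: f'(1))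
qed

text \<open>Definability as a property of predicates on valuations, without parameters: closure
  rules can then follow the shape of the HOL term, and formulas need not be written out.\<close>

definition fo_definable :: "((nat \<Rightarrow> real) \<Rightarrow> bool) \<Rightarrow> bool" where
  "fo_definable R \<longleftrightarrow> (\<exists>f. \<forall>e. holds e f \<longleftrightarrow> R e)"

lemma fo_definableI: "(\<And>e. holds e f \<longleftrightarrow> R e) \<Longrightarrow> fo_definable R"
  unfolding fo_definable_def by blast

text \<open>Stray variables of the formula are quantified away; as \<open>R\<close> does not depend
  on them, every witness gives the same truth value.\<close>

lemma fo_definable_restrict_vars:
  assumes "fo_definable R"
    and cong: "\<And>e e'. (\<And>n. n \<in> V \<Longrightarrow> e n = e' n) \<Longrightarrow> R e \<longleftrightarrow> R e'"
  shows "\<exists>f. free_vars f \<subseteq> V \<and> (\<forall>e. holds e f \<longleftrightarrow> R e)"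
proof -
  obtain f where f: "\<And>e. holds e f \<longleftrightarrow> R e" using assms(1) unfolding fo_definable_def by blast
  obtain f' where f': "free_vars f' = free_vars f - (free_vars f - V)"
      "\<And>e. holds e f' \<longleftrightarrow> (\<exists>a. holds (\<lambda>n. if n \<in> free_vars f - V then a n else e n) f)"
    using holds_Ex_set[of "free_vars f - V" f] finite_free_vars[of f] by blast
  have "R (\<lambda>n. if n \<in> free_vars f - V then a n else e n) \<longleftrightarrow> R e" for a e
    by (rule cong) auto
  then have "holds e f' \<longleftrightarrow> R e" for e unfolding f' f by simp
  then show ?thesis using f'(1) by (intro exI[of _ f']) auto
qed

lemma fo_definable_finite_support:
  assumes "fo_definable R"
  obtains N where "\<And>e e'. (\<And>n. n < N \<Longrightarrow> e n = e' n) \<Longrightarrow> R e \<longleftrightarrow> R e'"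
proof -
  obtain f where f: "\<And>e. holds e f \<longleftrightarrow> R e" using assms(1) unfolding fo_definable_def by blast
  obtain N where "\<And>n. n \<in> free_vars f \<Longrightarrow> n < N"
    using finite_free_vars[of f] unfolding finite_nat_set_iff_bounded by auto
  then have "R e \<longleftrightarrow> R e'" if "\<And>n. n < N \<Longrightarrow> e n = e' n" for e e'
    using holds_cong[of f e e'] that unfolding f by simp
  then show ?thesis by (rule that)
qed

lemma fo_definable_rename:
  assumes "fo_definable R"
  shows "fo_definable (\<lambda>e. R (\<lambda>n. e (\<sigma> n)))"
proof -
  obtain f where f: "\<And>e. holds e f \<longleftrightarrow> R e" using assms unfolding fo_definable_def by blast
  obtain f' where "\<And>e. holds e f' \<longleftrightarrow> holds (\<lambda>n. e (\<sigma> n)) f" using holds_rename by blast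
  then show ?thesis by (intro fo_definableI[of f']) (simp add: f)
qed

lemma fo_definable_not: "fo_definable R \<Longrightarrow> fo_definable (\<lambda>e. \<not> R e)"
  unfolding fo_definable_def using holds.simps(3) by blast

lemma fo_definable_conj:
  assumes "fo_definable R" "fo_definable S"
  shows "fo_definable (\<lambda>e. R e \<and> S e)"
proof -
  obtain f g where "\<And>e. holds e f \<longleftrightarrow> R e" "\<And>e. holds e g \<longleftrightarrow> S e"
    using assms unfolding fo_definable_def by blast
  then show ?thesis by (intro fo_definableI[of "FAnd f g"]) simp
qed

lemma fo_definable_disj:
  "fo_definable R \<Longrightarrow> fo_definable S \<Longrightarrow> fo_definable (\<lambda>e. R e \<or> S e)"
  using fo_definable_not[OF fo_definable_conj[OF fo_definable_not[of R] fo_definable_not[of S]]]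
  by simp

lemma fo_definable_const: "fo_definable (\<lambda>_. b)"
proof -
  have "fo_definable (\<lambda>_. True)"
    by (rule fo_definableI[of "FEq TZero TZero"]) simp
  then show ?thesis using fo_definable_not[of "\<lambda>_. True"] by (cases b) auto
qed

lemma fo_definable_ball:
  assumes "finite X" "\<And>x. x \<in> X \<Longrightarrow> fo_definable (R x)"
  shows "fo_definable (\<lambda>e. \<forall>x\<in>X. R x e)"
  using assms by (induction X) (simp_all add: fo_definable_conj fo_definable_const)

lemma fo_definable_bex:
  assumes "finite X" "\<And>x. x \<in> X \<Longrightarrow> fo_definable (R x)"
  shows "fo_definable (\<lambda>e. \<exists>x\<in>X. R x e)"
  using assms by (induction X) (simp_all add: fo_definable_disj fo_definable_const)

text \<open>\<open>V\<close> may be infinite, since only the finitely many variables of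
  \<open>V\<close> that occur free in the formula need a quantifier.\<close>

lemma fo_definable_ex:
  assumes "fo_definable R"
  shows "fo_definable (\<lambda>e. \<exists>a. R (\<lambda>n. if n \<in> V then a n else e n))"
proof -
  obtain f where f: "\<And>e. holds e f \<longleftrightarrow> R e" using assms unfolding fo_definable_def by blast
  obtain f' where f':
      "\<And>e. holds e f' \<longleftrightarrow> (\<exists>a. holds (\<lambda>n. if n \<in> V \<inter> free_vars f then a n else e n) f)"
    using holds_Ex_set[of "V \<inter> free_vars f" f] finite_free_vars[of f] by blast
  have "holds (\<lambda>n. if n \<in> V \<inter> free_vars f then a n else e n) f \<longleftrightarrow>
        holds (\<lambda>n. if n \<in> V then a n else e n) f" for a e
    by (rule holds_cong) auto
  then show ?thesis using f' f by (intro fo_definableI[of f']) auto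
qed

text \<open>Projection of a planar relation; it splits a definable complex constant into its real
  and imaginary part.\<close>

lemma fo_definable_ex1:
  assumes "fo_definable (\<lambda>e. R (e 0) (e 1))"
  shows "fo_definable (\<lambda>e. \<exists>b. R (e 0) b)"
proof -
  have "(\<lambda>e. \<exists>a :: nat \<Rightarrow> real. R (if 0 \<in> {1::nat} then a 0 else e 0) (if 1 \<in> {1::nat} then a 1 else e 1)) =
      (\<lambda>e :: nat \<Rightarrow> real. \<exists>b. R (e 0) b)"
  proof (rule ext, rule iffI)
    fix e :: "nat \<Rightarrow> real"
    assume "\<exists>b. R (e 0) b"
    then obtain b where "R (e 0) b" ..
    then show "\<exists>a :: nat \<Rightarrow> real. R (if 0 \<in> {1::nat} then a 0 else e 0) (if 1 \<in> {1::nat} then a 1 else e 1)"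
      by (intro exI[of _ "\<lambda>_. b"]) simp
  qed auto
  then show ?thesis using fo_definable_ex[OF assms, of "{1}"] by simp
qed

text \<open>Definability of the graph: variable 0 carries the value and the arguments move up by one
  place. This covers functions that no term expresses, such as division.\<close>

definition fo_fun :: "((nat \<Rightarrow> real) \<Rightarrow> real) \<Rightarrow> bool" where
  "fo_fun F \<longleftrightarrow> fo_definable (\<lambda>e. e 0 = F (\<lambda>n. e (Suc n)))"

text \<open>Definable functions are not terms, so they enter through quantified variables that hold
  their values. \<open>R\<close> looks at finitely many variables, hence finitely many graph
  equations suffice.\<close>

lemma fo_definable_subst:
  assumes R: "fo_definable R" and F: "\<And>n. fo_fun (F n)"
  shows "fo_definable (\<lambda>e. R (\<lambda>n. F n e))"
proof -
  obtain N where N: "\<And>e e'. (\<And>n. n < N \<Longrightarrow> e n = e' n) \<Longrightarrow> R e \<longleftrightarrow> R e'"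
    using fo_definable_finite_support[OF R] by blast
  \<comment> \<open>Even variables hold the values of the functions, odd ones the arguments, so the
    two never clash.\<close>
  let ?S = "\<lambda>e. (\<forall>n\<in>{..<N}. e (2 * n) = F n (\<lambda>m. e (2 * m + 1))) \<and> R (\<lambda>n. e (2 * n))"
  have "fo_definable ?S"
  proof (intro fo_definable_conj fo_definable_ball)
    show "fo_definable (\<lambda>e. e (2 * n) = F n (\<lambda>m. e (2 * m + 1)))" for n
      using fo_definable_rename[OF F[of n, unfolded fo_fun_def],
          of "\<lambda>i. case i of 0 \<Rightarrow> 2 * n | Suc m \<Rightarrow> 2 * m + 1"] by simp
    show "fo_definable (\<lambda>e. R (\<lambda>n. e (2 * n)))" by (rule fo_definable_rename[OF R])
  qed simp
  then have "fo_definable (\<lambda>e. \<exists>a. ?S (\<lambda>n. if n \<in> {n. even n} then a n else e n))"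
    by (rule fo_definable_ex)
  \<comment> \<open>The even variables are bound by now; \<open>n div 2\<close> makes the odd
    variable \<open>2 * m + 1\<close> read argument \<open>m\<close> again.\<close>
  then have "fo_definable (\<lambda>e. \<exists>a. ?S (\<lambda>n. if n \<in> {n. even n} then a n else e (n div 2)))"
    by (rule fo_definable_rename)
  also have "(\<lambda>e. \<exists>a. ?S (\<lambda>n. if n \<in> {n. even n} then a n else e (n div 2))) =
      (\<lambda>e. R (\<lambda>n. F n e))"
  proof (rule ext, rule iffI)
    fix e
    assume "\<exists>a. ?S (\<lambda>n. if n \<in> {n. even n} then a n else e (n div 2))"
    then obtain a where a: "\<And>n. n < N \<Longrightarrow> a (2 * n) = F n e" "R (\<lambda>n. a (2 * n))" by auto
    then show "R (\<lambda>n. F n e)" using N[of "\<lambda>n. a (2 * n)" "\<lambda>n. F n e"] by simp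
  next
    fix e
    assume "R (\<lambda>n. F n e)"
    then show "\<exists>a. ?S (\<lambda>n. if n \<in> {n. even n} then a n else e (n div 2))"
      by (intro exI[of _ "\<lambda>n. F (n div 2) e"]) simp
  qed
  finally show ?thesis .
qed

lemma fo_fun_var: "fo_fun (\<lambda>e. e n)"
  unfolding fo_fun_def by (rule fo_definableI[of "FEq (TVar 0) (TVar (Suc n))"]) simp

lemma fo_fun_rename:
  assumes "fo_fun F"
  shows "fo_fun (\<lambda>e. F (\<lambda>n. e (\<sigma> n)))"
  using fo_definable_rename[OF assms[unfolded fo_fun_def],
      of "\<lambda>i. case i of 0 \<Rightarrow> 0 | Suc m \<Rightarrow> Suc (\<sigma> m)"]
  unfolding fo_fun_def by simp

lemma fo_definable_subst2:
  assumes "fo_definable (\<lambda>e. R (e 0) (e 1))" "fo_fun F" "fo_fun G"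
  shows "fo_definable (\<lambda>e. R (F e) (G e))"
  using fo_definable_subst[OF assms(1), of "\<lambda>n. if n = 0 then F else G"] assms(2,3) by simp

lemma fo_fun_comp2:
  assumes h: "fo_definable (\<lambda>e. e 0 = h (e 1) (e 2))" and F: "fo_fun F" and G: "fo_fun G"
  shows "fo_fun (\<lambda>e. h (F e) (G e))"
proof -
  let ?F = "\<lambda>n. if n = 0 then (\<lambda>e. e 0) else if n = 1 then (\<lambda>e. F (\<lambda>n. e (Suc n)))
     else (\<lambda>e. G (\<lambda>n. e (Suc n)))"
  have "fo_fun (?F n)" for n
    using fo_fun_var fo_fun_rename[OF F] fo_fun_rename[OF G] by simp
  from fo_definable_subst[of _ ?F, OF h this] show ?thesis unfolding fo_fun_def by simp
qed

lemma fo_definable_eq: "fo_fun F \<Longrightarrow> fo_fun G \<Longrightarrow> fo_definable (\<lambda>e. F e = G e)"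
  by (rule fo_definable_subst2[where R = "(=)"])
     (auto intro: fo_definableI[of "FEq (TVar 0) (TVar 1)"])

lemma fo_definable_less: "fo_fun F \<Longrightarrow> fo_fun G \<Longrightarrow> fo_definable (\<lambda>e. F e < G e)"
  by (rule fo_definable_subst2[where R = "(<)"])
     (auto intro: fo_definableI[of "FLess (TVar 0) (TVar 1)"])

lemma fo_definable_le: "fo_fun F \<Longrightarrow> fo_fun G \<Longrightarrow> fo_definable (\<lambda>e. F e \<le> G e)"
  using fo_definable_not[OF fo_definable_less[of G F]] by (simp add: not_less)

lemma fo_fun_add: "fo_fun F \<Longrightarrow> fo_fun G \<Longrightarrow> fo_fun (\<lambda>e. F e + G e)"
  by (rule fo_fun_comp2) (auto intro: fo_definableI[of "FEq (TVar 0) (TAdd (TVar 1) (TVar 2))"])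

lemma fo_fun_mult: "fo_fun F \<Longrightarrow> fo_fun G \<Longrightarrow> fo_fun (\<lambda>e. F e * G e)"
  by (rule fo_fun_comp2) (auto intro: fo_definableI[of "FEq (TVar 0) (TMul (TVar 1) (TVar 2))"])

lemma fo_fun_diff: "fo_fun F \<Longrightarrow> fo_fun G \<Longrightarrow> fo_fun (\<lambda>e. F e - G e)"
  by (rule fo_fun_comp2) (auto intro: fo_definableI[of "FEq (TAdd (TVar 0) (TVar 2)) (TVar 1)"])

lemma fo_fun_exp: "fo_fun F \<Longrightarrow> fo_fun (\<lambda>e. exp (F e))"
  by (rule fo_fun_comp2[where h = "\<lambda>x _. exp x"])
     (auto intro: fo_definableI[of "FEq (TVar 0) (TExp (TVar 1))"])

lemma fo_fun_0: "fo_fun (\<lambda>_. 0)" and fo_fun_1: "fo_fun (\<lambda>_. 1)"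
  unfolding fo_fun_def
  by (rule fo_definableI[of "FEq (TVar 0) TZero"] fo_definableI[of "FEq (TVar 0) TOne"], simp)+

lemma fo_fun_minus: "fo_fun F \<Longrightarrow> fo_fun (\<lambda>e. - F e)"
  using fo_fun_diff[OF fo_fun_0, of F] by simp

lemma fo_fun_inverse: "fo_fun F \<Longrightarrow> fo_fun (\<lambda>e. inverse (F e))"
proof (rule fo_fun_comp2[where h = "\<lambda>x _. inverse x"])
  \<comment> \<open>The first disjunct accounts for the convention
    \<open>inverse 0 = 0\<close>.\<close>
  have "fo_definable (\<lambda>e. (e 1 = 0 \<and> e 0 = 0) \<or> e 0 * e 1 = 1)"
    by (intro fo_definable_disj fo_definable_conj fo_definable_eq fo_fun_var fo_fun_0 fo_fun_1
        fo_fun_mult)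
  also have "(\<lambda>e. (e 1 = 0 \<and> e 0 = 0) \<or> e 0 * e 1 = 1) = (\<lambda>e. e 0 = inverse (e 1 :: real))"
    by (intro ext) (case_tac "e 1 = 0"; simp add: field_simps)
  finally show "fo_definable (\<lambda>e. e 0 = inverse (e 1))" .
qed

lemma fo_fun_divide: "fo_fun F \<Longrightarrow> fo_fun G \<Longrightarrow> fo_fun (\<lambda>e. F e / G e)"
  unfolding divide_inverse by (intro fo_fun_mult fo_fun_inverse)

lemma fo_fun_prod: "(\<And>x. x \<in> X \<Longrightarrow> fo_fun (F x)) \<Longrightarrow> fo_fun (\<lambda>e. \<Prod>x\<in>X. F x e)"
  by (induction X rule: infinite_finite_induct) (auto intro: fo_fun_mult fo_fun_1)

lemma fo_fun_of_nat: "fo_fun (\<lambda>_. real n)"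
  by (induction n) (auto intro: fo_fun_0 fo_fun_1 fo_fun_add)

lemma fo_fun_of_int: "fo_fun (\<lambda>_. real_of_int n)"
  using fo_fun_of_nat[of "nat n"] fo_fun_minus[OF fo_fun_of_nat[of "nat (- n)"]]
  by (cases "n \<ge> 0") auto

lemma fo_fun_of_rat: "fo_fun (\<lambda>_. real_of_rat q)"
proof (cases q)
  case (Fract a b)
  then show ?thesis
    using fo_fun_divide[OF fo_fun_of_int[of a] fo_fun_of_int[of b]] by (simp add: of_rat_rat)
qed

lemma fo_fun_gbinomial:
  assumes "fo_fun F"
  shows "fo_fun (\<lambda>e. F e gchoose c)"
  unfolding gbinomial_prod_rev
  using fo_fun_of_nat[of "fact c"]
  by (auto intro!: fo_fun_divide fo_fun_prod fo_fun_diff assms fo_fun_of_nat)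

section \<open>Definable real constants\<close>

lemma fo_fun_const_ln:
  assumes "fo_fun (\<lambda>_. r)" "r > 0"
  shows "fo_fun (\<lambda>_. ln r)"
proof -
  have "fo_definable (\<lambda>e. exp (e 0) = r)"
    by (intro fo_definable_eq fo_fun_exp fo_fun_var assms)
  also have "(\<lambda>e. exp (e 0) = r) = (\<lambda>e :: nat \<Rightarrow> real. e 0 = ln r)"
    using assms(2) by auto
  finally show ?thesis unfolding fo_fun_def .
qed

lemma fo_fun_const_unique:
  assumes "fo_definable R" "\<And>e. R e \<longleftrightarrow> e 0 = c"
  shows "fo_fun (\<lambda>_. c)"
proof -
  have "R = (\<lambda>e. e 0 = c)" using assms(2) by blast
  then show ?thesis using assms(1) unfolding fo_fun_def by simp
qed

lemma fo_fun_const_sqrt: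
  assumes "fo_fun (\<lambda>_. r)" "r \<ge> 0"
  shows "fo_fun (\<lambda>_. sqrt r)"
proof (rule fo_fun_const_unique)
  show "fo_definable (\<lambda>e. 0 \<le> e 0 \<and> e 0 * e 0 = r)"
    by (intro fo_definable_conj fo_definable_eq fo_definable_le fo_fun_mult fo_fun_var fo_fun_0 assms)
  show "(0 \<le> e 0 \<and> e 0 * e 0 = r) \<longleftrightarrow> e 0 = sqrt r" for e :: "nat \<Rightarrow> real"
    using assms(2) real_sqrt_unique[of "e 0" r] by (auto simp: power2_eq_square)
qed

section \<open>Complex-valued definable functions and algebraic constants\<close>

definition cfo_fun :: "((nat \<Rightarrow> real) \<Rightarrow> complex) \<Rightarrow> bool" where
  "cfo_fun F \<longleftrightarrow> fo_fun (\<lambda>e. Re (F e)) \<and> fo_fun (\<lambda>e. Im (F e))"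

lemma cfo_fun_of_real: "fo_fun F \<Longrightarrow> cfo_fun (\<lambda>e. of_real (F e))"
  unfolding cfo_fun_def by (simp add: fo_fun_0)

lemma cfo_fun_Complex: "fo_fun F \<Longrightarrow> fo_fun G \<Longrightarrow> cfo_fun (\<lambda>e. Complex (F e) (G e))"
  unfolding cfo_fun_def by simp

lemma cfo_fun_of_rat: "cfo_fun (\<lambda>_. of_rat q)"
proof (cases q)
  case (Fract a b)
  then show ?thesis
    using cfo_fun_of_real[OF fo_fun_of_rat[of q]] by (simp add: of_rat_rat)
qed

lemma cfo_fun_0: "cfo_fun (\<lambda>_. 0)" and cfo_fun_1: "cfo_fun (\<lambda>_. 1)"
  using cfo_fun_of_rat[of 0] cfo_fun_of_rat[of 1] by auto

lemma cfo_fun_add: "cfo_fun F \<Longrightarrow> cfo_fun G \<Longrightarrow> cfo_fun (\<lambda>e. F e + G e)"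
  unfolding cfo_fun_def by (auto intro: fo_fun_add)

lemma cfo_fun_diff: "cfo_fun F \<Longrightarrow> cfo_fun G \<Longrightarrow> cfo_fun (\<lambda>e. F e - G e)"
  unfolding cfo_fun_def by (auto intro: fo_fun_diff)

lemma cfo_fun_mult: "cfo_fun F \<Longrightarrow> cfo_fun G \<Longrightarrow> cfo_fun (\<lambda>e. F e * G e)"
  unfolding cfo_fun_def by (auto intro!: fo_fun_diff fo_fun_add fo_fun_mult)

lemma cfo_fun_inverse: "cfo_fun F \<Longrightarrow> cfo_fun (\<lambda>e. inverse (F e))"
  unfolding cfo_fun_def power2_eq_square inverse_complex.sel
  by (auto intro!: fo_fun_divide fo_fun_add fo_fun_mult fo_fun_minus)

lemma cfo_fun_sum: "(\<And>x. x \<in> X \<Longrightarrow> cfo_fun (F x)) \<Longrightarrow> cfo_fun (\<lambda>e. \<Sum>x\<in>X. F x e)"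
  by (induction X rule: infinite_finite_induct) (auto intro: cfo_fun_add cfo_fun_0)

lemma cfo_fun_prod: "(\<And>x. x \<in> X \<Longrightarrow> cfo_fun (F x)) \<Longrightarrow> cfo_fun (\<lambda>e. \<Prod>x\<in>X. F x e)"
  by (induction X rule: infinite_finite_induct) (auto intro: cfo_fun_mult cfo_fun_1)

lemma cfo_fun_power: "cfo_fun F \<Longrightarrow> cfo_fun (\<lambda>e. F e ^ n)"
  by (induction n) (auto intro: cfo_fun_mult cfo_fun_1)

lemma cfo_fun_powi: "cfo_fun F \<Longrightarrow> cfo_fun (\<lambda>e. F e powi n)"
  by (cases "n \<ge> 0") (simp_all add: power_int_def cfo_fun_power cfo_fun_inverse)

lemma fo_definable_ceq: "cfo_fun F \<Longrightarrow> cfo_fun G \<Longrightarrow> fo_definable (\<lambda>e. F e = G e)"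
  unfolding cfo_fun_def complex_eq_iff by (auto intro: fo_definable_conj fo_definable_eq)

lemma fo_fun_const_cmod:
  assumes "cfo_fun (\<lambda>_. z)"
  shows "fo_fun (\<lambda>_. cmod z)"
  unfolding cmod_def power2_eq_square
  using assms unfolding cfo_fun_def
  by (auto intro!: fo_fun_const_sqrt fo_fun_add fo_fun_mult)

text \<open>Rational bounds need no parameters, so such a box can be written into a formula. It
  extends from \<open>z\<close> by less than half a lower bound for the distance to the other points
  of \<open>S\<close>.\<close>

lemma isolating_rational_box:
  assumes "finite S"
  obtains a b c d :: rat where
    "of_rat a < Re z" "Re z < of_rat b" "of_rat c < Im z" "Im z < of_rat d"
    "\<And>w. w \<in> S \<Longrightarrow> of_rat a < Re w \<Longrightarrow> Re w < of_rat b \<Longrightarrow> of_rat c < Im w \<Longrightarrow>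
       Im w < of_rat d \<Longrightarrow> w = z"
proof -
  obtain \<epsilon> where \<epsilon>: "\<epsilon> > 0" "\<And>w. w \<in> S \<Longrightarrow> w \<noteq> z \<Longrightarrow> \<epsilon> \<le> dist z w"
  \<comment> \<open>The element 1 keeps the set nonempty when \<open>S\<close> has no point besides
    \<open>z\<close>.\<close>
  proof (rule that[of "Min (insert 1 (dist z ` (S - {z})))"])
    show "Min (insert 1 (dist z ` (S - {z}))) > 0" using assms by auto
    show "Min (insert 1 (dist z ` (S - {z}))) \<le> dist z w" if "w \<in> S" "w \<noteq> z" for w
      using assms that by (intro Min_le) auto
  qed
  have gt: "\<exists>q. real_of_rat q < r \<and> r - \<epsilon>/2 < of_rat q" for r
    using of_rat_dense[of "r - \<epsilon>/2" r] \<epsilon>(1) by (simp add: conj_commute)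
  have lt: "\<exists>q. r < real_of_rat q \<and> of_rat q < r + \<epsilon>/2" for r
    using of_rat_dense[of r "r + \<epsilon>/2"] \<epsilon>(1) by simp
  obtain a where a: "of_rat a < Re z" "Re z - \<epsilon>/2 < of_rat a" using gt by blast
  obtain b where b: "Re z < of_rat b" "of_rat b < Re z + \<epsilon>/2" using lt by blast
  obtain c where c: "of_rat c < Im z" "Im z - \<epsilon>/2 < of_rat c" using gt by blast
  obtain d where d: "Im z < of_rat d" "of_rat d < Im z + \<epsilon>/2" using lt by blast
  note q = a b c d
  show ?thesis
  proof (rule that[OF q(1,3,5,7)], rule ccontr)
    fix w assume w: "w \<in> S" "of_rat a < Re w" "Re w < of_rat b" "of_rat c < Im w"
       "Im w < of_rat d" "w \<noteq> z"
    have "dist z w \<le> \<bar>Re (z - w)\<bar> + \<bar>Im (z - w)\<bar>" unfolding dist_norm by (rule cmod_le)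
    also have "\<bar>Re (z - w)\<bar> < \<epsilon>/2" using w q unfolding minus_complex.sel by linarith
    also have "\<bar>Im (z - w)\<bar> < \<epsilon>/2" using w q unfolding minus_complex.sel by linarith
    also have "\<epsilon>/2 + \<epsilon>/2 = \<epsilon>" by (rule field_sum_of_halves)
    finally show False using \<epsilon>(2)[OF w(1,6)] by simp
  qed
qed

text \<open>The number is the only root in some rational box, and this description is first-order in
  its real and imaginary part.\<close>

lemma cfo_fun_const_root:
  fixes p :: "complex poly"
  assumes coeffs: "\<And>n. cfo_fun (\<lambda>_. coeff p n)" and "p \<noteq> 0" and root: "poly p z = 0"
  shows "cfo_fun (\<lambda>_. z)"
proof -
  obtain a b c d :: rat where z: "of_rat a < Re z" "Re z < of_rat b" "of_rat c < Im z"
      "Im z < of_rat d" and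
    uniq: "\<And>w. w \<in> {w. poly p w = 0} \<Longrightarrow> of_rat a < Re w \<Longrightarrow> Re w < of_rat b \<Longrightarrow>
       of_rat c < Im w \<Longrightarrow> Im w < of_rat d \<Longrightarrow> w = z"
    apply (rule isolating_rational_box[OF poly_roots_finite[OF \<open>p \<noteq> 0\<close>], of z])
    subgoal premises prems for a b c d by (rule prems(1)[OF prems(2-6)])
    done
  let ?R = "\<lambda>e :: nat \<Rightarrow> real. poly p (Complex (e 0) (e 1)) = 0 \<and> of_rat a < e 0 \<and> e 0 < of_rat b \<and>
      of_rat c < e 1 \<and> e 1 < of_rat d"
  have "fo_definable ?R"
    unfolding poly_altdef[of p]
    by (intro fo_definable_conj fo_definable_ceq fo_definable_less fo_fun_of_rat cfo_fun_sum
        cfo_fun_mult cfo_fun_power cfo_fun_Complex fo_fun_var coeffs cfo_fun_0)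
  moreover have R: "?R e \<longleftrightarrow> e 0 = Re z \<and> e 1 = Im z" for e
  proof
    assume "?R e"
    then have "Complex (e 0) (e 1) = z" using uniq[of "Complex (e 0) (e 1)"] by simp
    then show "e 0 = Re z \<and> e 1 = Im z" by (simp add: complex_eq_iff)
  next
    assume "e 0 = Re z \<and> e 1 = Im z"
    then show "?R e" using z root by simp
  qed
  ultimately have "fo_definable (\<lambda>e. e 0 = Re z \<and> e 1 = Im z)" unfolding R by blast
  note RI = this
  \<comment> \<open>Truncated subtraction swaps variables 0 and 1, so the same projection also
    delivers the imaginary part.\<close>
  from fo_definable_rename[OF RI, of "\<lambda>n. 1 - n"]
  have "fo_definable (\<lambda>e. e 1 = Re z \<and> e 0 = Im z)" by simp
  from fo_definable_ex1[OF RI] fo_definable_ex1[OF this]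
  show ?thesis unfolding cfo_fun_def fo_fun_def by simp
qed

subsection \<open>Subgroups of the integer lattice\<close>

lemma subgroup_zmult_mem:
  fixes H :: "(nat \<Rightarrow> int) set"
  assumes "(\<lambda>_. 0) \<in> H" and diff: "\<And>a b. a \<in> H \<Longrightarrow> b \<in> H \<Longrightarrow> (\<lambda>i. a i - b i) \<in> H" and "a \<in> H"
  shows "(\<lambda>i. n * a i) \<in> H"
proof -
  have uminus: "(\<lambda>i. - b i) \<in> H" if "b \<in> H" for b using diff[OF assms(1) that] by simp
  have nat: "(\<lambda>i. int m * a i) \<in> H" for m
  proof (induction m)
    case 0
    then show ?case using assms(1) by simp
  next
    case (Suc m)
    have "(\<lambda>i. int m * a i - (- a i)) \<in> H" by (rule diff[OF Suc uminus[OF assms(3)]])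
    then show ?case by (simp add: algebra_simps)
  qed
  show ?thesis
  proof (cases "n \<ge> 0")
    case True
    then show ?thesis using nat[of "nat n"] by simp
  next
    case False
    then show ?thesis using uminus[OF nat[of "nat (- n)"]] by simp
  qed
qed

text \<open>Generation is expressed through arbitrary difference-closed sets \<open>H'\<close>
  instead of integer combinations, the form needed for the relations satisfied by a given point. In
  the induction, an element \<open>g\<close> with least positive last coordinate is added to
  generators of the part of \<open>H\<close> where that coordinate vanishes.\<close>

lemma int_lattice_finitely_generated:
  fixes H :: "(nat \<Rightarrow> int) set"
  assumes "(\<lambda>_. 0) \<in> H" "\<And>a b. a \<in> H \<Longrightarrow> b \<in> H \<Longrightarrow> (\<lambda>i. a i - b i) \<in> H"
    and "\<And>a i. a \<in> H \<Longrightarrow> i \<ge> k \<Longrightarrow> a i = 0"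
  shows "\<exists>S. finite S \<and> S \<subseteq> H \<and> (\<forall>H'. S \<subseteq> H' \<longrightarrow> (\<lambda>_. 0) \<in> H' \<longrightarrow>
           (\<forall>a\<in>H'. \<forall>b\<in>H'. (\<lambda>i. a i - b i) \<in> H') \<longrightarrow> H \<subseteq> H')"
  using assms
proof (induction k arbitrary: H)
  case 0
  then have "H \<subseteq> {\<lambda>_. 0}" by (auto simp: fun_eq_iff)
  then show ?case by (intro exI[of _ "{}"]) auto
next
  case (Suc k)
  show ?case
  proof (cases "\<forall>h\<in>H. h k = 0")
    case True
    show ?thesis
    proof (rule Suc.IH)
      show "a i = 0" if "a \<in> H" "i \<ge> k" for a i
        using True Suc.prems(3)[OF that(1), of i] that by (cases "i = k") auto
    qed (use Suc.prems(1,2) in auto)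
  next
    case False
    define P where "P n \<longleftrightarrow> n > 0 \<and> (\<exists>h\<in>H. h k = int n)" for n
    obtain h where h: "h \<in> H" "h k \<noteq> 0" using False by blast
    have "(\<lambda>i. - h i) \<in> H" using Suc.prems(2)[OF Suc.prems(1) h(1)] by simp
    then have "P (nat \<bar>h k\<bar>)" using h unfolding P_def by (cases "h k > 0") (auto intro: bexI[of _ "\<lambda>i. - h i"])
    then have "P (Least P)" by (rule LeastI)
    then obtain g where g: "g \<in> H" "g k = int (Least P)" "Least P > 0" unfolding P_def by blast
    let ?H0 = "{h \<in> H. h k = 0}"
    have "\<exists>S. finite S \<and> S \<subseteq> ?H0 \<and> (\<forall>H'. S \<subseteq> H' \<longrightarrow> (\<lambda>_. 0) \<in> H' \<longrightarrow>
           (\<forall>a\<in>H'. \<forall>b\<in>H'. (\<lambda>i. a i - b i) \<in> H') \<longrightarrow> ?H0 \<subseteq> H')"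
    proof (rule Suc.IH)
      show "(\<lambda>_. 0) \<in> ?H0" using Suc.prems(1) by simp
      show "(\<lambda>i. a i - b i) \<in> ?H0" if "a \<in> ?H0" "b \<in> ?H0" for a b
        using Suc.prems(2)[of a b] that by simp
      show "a i = 0" if "a \<in> ?H0" "i \<ge> k" for a i
        using Suc.prems(3)[of a i] that by (cases "i = k") auto
    qed
    then obtain S where S: "finite S" "S \<subseteq> ?H0" and gen: "\<And>H'. S \<subseteq> H' \<Longrightarrow> (\<lambda>_. 0) \<in> H' \<Longrightarrow>
           \<forall>a\<in>H'. \<forall>b\<in>H'. (\<lambda>i. a i - b i) \<in> H' \<Longrightarrow> ?H0 \<subseteq> H'" by blast
    have "H \<subseteq> H'" if H': "insert g S \<subseteq> H'" "(\<lambda>_. 0) \<in> H'" "\<forall>a\<in>H'. \<forall>b\<in>H'. (\<lambda>i. a i - b i) \<in> H'" for H'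
    proof
      fix a assume a: "a \<in> H"
      \<comment> \<open>Division with remainder by \<open>g k\<close>: a nonzero remainder would be
        a smaller positive last coordinate.\<close>
      define q where "q = a k div g k"
      let ?r = "\<lambda>i. a i - q * g i" and ?m = "\<lambda>i. - q * g i"
      have r: "?r \<in> H"
        by (rule Suc.prems(2)[OF a subgroup_zmult_mem[OF Suc.prems(1,2) g(1)]])
      have rk: "?r k = a k mod g k" unfolding q_def by (simp add: minus_div_mult_eq_mod[symmetric])
      have "?r k = 0"
      proof (rule ccontr)
        assume "?r k \<noteq> 0"
        moreover have "?r k \<ge> 0" unfolding rk using g by simp
        ultimately have "P (nat (?r k))" unfolding P_def by (intro conjI bexI[of _ ?r] r) simp_all
        then have "Least P \<le> nat (?r k)" by (rule Least_le)
        moreover have "?r k < g k" unfolding rk using g by simp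
        ultimately show False using g by linarith
      qed
      then have "?r \<in> ?H0" using r by simp
      moreover have "?H0 \<subseteq> H'" by (rule gen[OF _ H'(2,3)]) (use H'(1) in simp)
      ultimately have r': "?r \<in> H'" by (rule rev_subsetD)
      have m: "?m \<in> H'" by (rule subgroup_zmult_mem) (use H' in auto)
      have "(\<lambda>i. ?r i - ?m i) \<in> H'" using bspec[OF H'(3) r'] m by (rule bspec)
      then show "a \<in> H'" by simp
    qed
    then show ?thesis using S g by (intro exI[of _ "insert g S"]) auto
  qed
qed

subsection \<open>Interpolating Taylor coefficients\<close>

text \<open>The \<open>c\<close>-th Taylor coefficient of \<open>p\<close> at \<open>\<nu>\<close> is \<open>coeff (p \<circ>\<^sub>p [:\<nu>, 1:]) c\<close>. The following polynomial
  is congruent to \<open>(X - \<mu>)^m\<close> modulo \<open>(X - \<mu>)^d\<close> and to \<open>0\<close> modulo \<open>(X - \<nu>)^d\<close> for the other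
  points \<open>\<nu>\<close> of \<open>S\<close>.\<close>

definition hermite_poly :: "'a :: field set \<Rightarrow> nat \<Rightarrow> 'a \<Rightarrow> nat \<Rightarrow> 'a poly" where
  "hermite_poly S d \<mu> m = [:- \<mu>, 1:] ^ m *
     (1 - (1 - (\<Prod>\<nu>\<in>S - {\<mu>}. Polynomial.smult (inverse (\<mu> - \<nu>)) [:- \<nu>, 1:] ^ d)) ^ d)"

lemma pcompose_power: "(p ^ n) \<circ>\<^sub>p (q :: 'a :: comm_ring_1 poly) = (p \<circ>\<^sub>p q) ^ n"
  by (induction n) (simp_all add: pcompose_mult)

lemma taylor_coeff_eq_0:
  fixes p :: "'a :: field poly"
  assumes "[:- \<nu>, 1:] ^ d dvd p" "c < d"
  shows "coeff (p \<circ>\<^sub>p [:\<nu>, 1:]) c = 0"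
proof -
  obtain q where q: "p = [:- \<nu>, 1:] ^ d * q" using assms(1) by (elim dvdE)
  have "p \<circ>\<^sub>p [:\<nu>, 1:] = monom 1 d * (q \<circ>\<^sub>p [:\<nu>, 1:])"
    unfolding q pcompose_mult pcompose_power by (simp add: pcompose_pCons monom_altdef)
  then show ?thesis using assms(2) by (simp add: coeff_monom_mult)
qed

text \<open>Let \<open>q\<close> be the product in the definition. Since \<open>q\<close> is 1 at
  \<open>\<mu>\<close>, the outer power makes \<open>(1 - q)^d\<close> divisible by
  \<open>(X - \<mu>)^d\<close>, leaving \<open>(X - \<mu>)^m\<close>. For another
  \<open>\<nu>\<close> in \<open>S\<close>, \<open>(X - \<nu>)^d\<close> divides \<open>q\<close>,
  and \<open>q\<close> divides \<open>1 - (1 - q)^d\<close>.\<close>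

lemma taylor_coeff_hermite_poly:
  fixes S :: "'a :: field set"
  assumes "finite S" "\<nu> \<in> S" "c < d"
  shows "coeff (hermite_poly S d \<mu> m \<circ>\<^sub>p [:\<nu>, 1:]) c = (if \<nu> = \<mu> \<and> c = m then 1 else 0)"
proof -
  let ?q = "\<Prod>\<nu>\<in>S - {\<mu>}. Polynomial.smult (inverse (\<mu> - \<nu>)) [:- \<nu>, 1:] ^ d"
  show ?thesis
  proof (cases "\<nu> = \<mu>")
    case True
    have "poly (Polynomial.smult (inverse (\<mu> - \<nu>)) [:- \<nu>, 1:]) \<mu> = 1" if "\<nu> \<noteq> \<mu>" for \<nu>
    proof -
      have "poly (Polynomial.smult (inverse (\<mu> - \<nu>)) [:- \<nu>, 1:]) \<mu> = inverse (\<mu> - \<nu>) * (\<mu> - \<nu>)"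
        by (simp add: algebra_simps)
      then show ?thesis using that by simp
    qed
    then have "poly ?q \<mu> = 1" unfolding poly_prod poly_power by (intro prod.neutral ballI) auto
    then have "[:- \<mu>, 1:] dvd 1 - ?q" by (simp add: poly_eq_0_iff_dvd[symmetric])
    then have "[:- \<mu>, 1:] ^ d dvd (1 - ?q) ^ d" by (rule dvd_power_same)
    then have "coeff (([:- \<mu>, 1:] ^ m * (1 - ?q) ^ d) \<circ>\<^sub>p [:\<nu>, 1:]) c = 0"
      using assms(3) unfolding True by (intro taylor_coeff_eq_0[of _ d]) auto
    moreover have "hermite_poly S d \<mu> m = [:- \<mu>, 1:] ^ m - [:- \<mu>, 1:] ^ m * (1 - ?q) ^ d"
      unfolding hermite_poly_def by (simp add: algebra_simps)
    moreover have "([:- \<mu>, 1:] ^ m) \<circ>\<^sub>p [:\<nu>, 1:] = monom 1 m"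
      unfolding pcompose_power True by (simp add: pcompose_pCons monom_altdef)
    ultimately show ?thesis using True by (simp add: pcompose_diff)
  next
    case False
    have "[:- \<nu>, 1:] ^ d dvd Polynomial.smult (inverse (\<mu> - \<nu>)) [:- \<nu>, 1:] ^ d"
      by (intro dvd_power_same dvd_smult) simp
    also have "\<dots> dvd ?q" using False assms by (intro dvd_prodI) auto
    also have "?q dvd 1 - (1 - ?q) ^ d" by (simp add: one_diff_power_eq)
    also have "\<dots> dvd hermite_poly S d \<mu> m" unfolding hermite_poly_def by simp
    finally show ?thesis using taylor_coeff_eq_0 assms(3) False by auto
  qed
qed

section \<open>Definable coefficients, conjugation, and Taylor coefficients as functionals\<close>

definition fo_poly :: "complex poly \<Rightarrow> bool" where
  "fo_poly p \<longleftrightarrow> (\<forall>n. cfo_fun (\<lambda>_. coeff p n))"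

lemma fo_poly_1: "fo_poly 1"
  unfolding fo_poly_def by (simp add: cfo_fun_0 cfo_fun_1)

lemma fo_poly_diff: "fo_poly p \<Longrightarrow> fo_poly q \<Longrightarrow> fo_poly (p - q)"
  unfolding fo_poly_def by (simp add: cfo_fun_diff)

lemma fo_poly_mult: "fo_poly p \<Longrightarrow> fo_poly q \<Longrightarrow> fo_poly (p * q)"
  unfolding fo_poly_def coeff_mult by (simp add: cfo_fun_mult cfo_fun_sum)

lemma fo_poly_smult: "cfo_fun (\<lambda>_. c) \<Longrightarrow> fo_poly p \<Longrightarrow> fo_poly (Polynomial.smult c p)"
  unfolding fo_poly_def by (simp add: cfo_fun_mult)

lemma fo_poly_linear: "cfo_fun (\<lambda>_. c) \<Longrightarrow> fo_poly [:- c, 1:]"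
  using cfo_fun_diff[OF cfo_fun_0, of "\<lambda>_. c"]
  unfolding fo_poly_def by (simp add: coeff_pCons cfo_fun_0 cfo_fun_1 split: nat.split)

lemma fo_poly_power: "fo_poly p \<Longrightarrow> fo_poly (p ^ n)"
  by (induction n) (simp_all add: fo_poly_1 fo_poly_mult)

lemma fo_poly_prod: "(\<And>x. x \<in> X \<Longrightarrow> fo_poly (p x)) \<Longrightarrow> fo_poly (\<Prod>x\<in>X. p x)"
  by (induction X rule: infinite_finite_induct) (simp_all add: fo_poly_1 fo_poly_mult)

lemma fo_poly_hermite_poly:
  assumes "\<And>\<nu>. \<nu> \<in> S \<Longrightarrow> cfo_fun (\<lambda>_. \<nu>)" "\<mu> \<in> S"
  shows "fo_poly (hermite_poly S d \<mu> m)"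
  unfolding hermite_poly_def
  by (intro fo_poly_mult fo_poly_diff fo_poly_power fo_poly_prod fo_poly_smult fo_poly_linear
      cfo_fun_inverse cfo_fun_diff fo_poly_1 assms) auto

text \<open>The polynomial is built from its nodes by field operations, with which conjugation
  commutes.\<close>

lemma map_poly_cnj_hermite_poly:
  "map_poly cnj (hermite_poly S d \<mu> m) = hermite_poly (cnj ` S) d (cnj \<mu>) m"
proof -
  interpret cnj: comm_ring_hom cnj by unfold_locales auto
  interpret map_poly_comm_ring_hom cnj ..
  have pair: "map_poly cnj [:x, y:] = [:cnj x, cnj y:]" for x y
    by (intro poly_eqI) (simp add: coeff_map_poly coeff_pCons split: nat.split)
  have lin: "map_poly cnj (Polynomial.smult a [:- \<nu>, 1:]) = Polynomial.smult (cnj a) [:- cnj \<nu>, 1:]"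
      "map_poly cnj [:- \<nu>, 1:] = [:- cnj \<nu>, 1:]" for a \<nu>
    by (simp_all add: pair)
  have "(\<Prod>\<nu>\<in>cnj ` S - {cnj \<mu>}. Polynomial.smult (inverse (cnj \<mu> - \<nu>)) [:- \<nu>, 1:] ^ d) =
     (\<Prod>\<nu>\<in>S - {\<mu>}. Polynomial.smult (inverse (cnj \<mu> - cnj \<nu>)) [:- cnj \<nu>, 1:] ^ d)"
  proof -
    have "cnj ` S - {cnj \<mu>} = cnj ` (S - {\<mu>})" by auto
    then show ?thesis by (simp add: prod.reindex inj_on_def)
  qed
  then show ?thesis
    unfolding hermite_poly_def hom_mult hom_power hom_minus hom_one hom_prod lin by simp
qed

lemma coeff_linear_power_eq:
  "coeff ([:a, 1:] ^ n) c = of_nat (n choose c) * (a :: 'a :: comm_ring_1) ^ (n - c)"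
proof (induction n arbitrary: c)
  case 0
  show ?case by (cases c) auto
next
  case (Suc n)
  have "coeff ([:a, 1:] ^ Suc n) c = a * coeff ([:a, 1:] ^ n) c + coeff (pCons 0 ([:a, 1:] ^ n)) c"
    by simp
  also have "\<dots> = of_nat (Suc n choose c) * a ^ (Suc n - c)"
  proof (cases c)
    case 0
    then show ?thesis by (simp add: Suc)
  next
    case c: (Suc c')
    show ?thesis
    proof (cases "c \<le> n")
      case True
      then have "n - c' = Suc (n - c)" using c by simp
      then show ?thesis by (simp add: Suc c algebra_simps)
    next
      case False
      then show ?thesis by (simp add: Suc c binomial_eq_0)
    qed
  qed
  finally show ?case .
qed

text \<open>By linearity in \<open>p\<close>, the functional sending \<open>X^n\<close> to the sequence
  \<open>\<mu>^n (\<Sum>c<N. (n choose c) \<mu>^(-c) x c)\<close> reads off the Taylor coefficients of \<open>p\<close> at \<open>\<mu>\<close>.\<close>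

lemma sum_coeff_taylor:
  fixes p :: "complex poly"
  assumes "\<mu> \<noteq> 0"
  shows "(\<Sum>n\<le>degree p. coeff p n * (\<mu> ^ n * (\<Sum>c<N. complex_of_real (real n gchoose c) *
            \<mu> powi (- int c) * x c))) = (\<Sum>c<N. coeff (p \<circ>\<^sub>p [:\<mu>, 1:]) c * x c)"
proof -
  have tc: "coeff (p \<circ>\<^sub>p [:\<mu>, 1:]) c = (\<Sum>n\<le>degree p. coeff p n * (\<mu> ^ n *
      (complex_of_real (real n gchoose c) * \<mu> powi (- int c))))" for c
  proof -
    have "p \<circ>\<^sub>p [:\<mu>, 1:] = (\<Sum>n\<le>degree p. Polynomial.smult (coeff p n) ([:\<mu>, 1:] ^ n))"
    proof -
      have "p \<circ>\<^sub>p [:\<mu>, 1:] = (\<Sum>n\<le>degree p. monom (coeff p n) n) \<circ>\<^sub>p [:\<mu>, 1:]"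
        by (simp add: poly_as_sum_of_monoms)
      also have "\<dots> = (\<Sum>n\<le>degree p. Polynomial.smult (coeff p n) ([:\<mu>, 1:] ^ n))"
        by (simp add: pcompose_sum monom_altdef pcompose_smult pcompose_power pcompose_pCons)
      finally show ?thesis .
    qed
    then have "coeff (p \<circ>\<^sub>p [:\<mu>, 1:]) c = (\<Sum>n\<le>degree p. coeff p n * coeff ([:\<mu>, 1:] ^ n) c)"
      by (simp add: coeff_sum)
    also have "\<dots> = (\<Sum>n\<le>degree p. coeff p n * (\<mu> ^ n *
        (complex_of_real (real n gchoose c) * \<mu> powi (- int c))))"
    proof (rule sum.cong[OF refl])
      fix n
      have "coeff ([:\<mu>, 1:] ^ n) c = \<mu> ^ n * (of_nat (n choose c) * \<mu> powi (- int c))"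
      proof (cases "c \<le> n")
        case True
        then show ?thesis using assms
          by (simp add: coeff_linear_power_eq power_diff power_int_minus field_simps)
      next
        case False
        then show ?thesis by (simp add: coeff_linear_power_eq binomial_eq_0)
      qed
      also have "of_nat (n choose c) = complex_of_real (real n gchoose c)"
        by (metis binomial_gbinomial of_real_of_nat_eq)
      finally show "coeff p n * coeff ([:\<mu>, 1:] ^ n) c = coeff p n * (\<mu> ^ n *
        (complex_of_real (real n gchoose c) * \<mu> powi (- int c)))" by simp
    qed
    finally show ?thesis .
  qed
  show ?thesis unfolding tc sum_distrib_right sum_distrib_left
    by (subst sum.swap) (simp add: mult_ac)
qed

subsection \<open>Jordan matrices and their trajectories\<close>

lemma sum_lessThan_add:
  "(\<Sum>u<a + n. f u) = (\<Sum>u<a. f u) + (\<Sum>j<n. f (a + j :: nat) :: 'a :: comm_monoid_add)"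
  by (induction n) (simp_all add: add.assoc)

lemma sum_coord:
  "(\<Sum>u<(\<Sum>l<k. ds l). f u) = (\<Sum>i<k. \<Sum>j<ds i. f (coord ds i j) :: 'a :: comm_monoid_add)"
  by (induction k) (simp_all add: sum_lessThan_add coord_def)

lemma coord_less:
  assumes "i < i'" "j < ds i"
  shows "coord ds i j < (\<Sum>l<i'. ds l)"
proof -
  have "coord ds i j < (\<Sum>l<Suc i. ds l)" using assms(2) by (simp add: coord_def)
  also have "\<dots> \<le> (\<Sum>l<i'. ds l)" using assms(1) by (intro sum_mono2) auto
  finally show ?thesis .
qed

lemma coord_inject:
  assumes "j < ds i" "j' < ds i'"
  shows "coord ds i j = coord ds i' j' \<longleftrightarrow> i = i' \<and> j = j'"
proof -
  have "coord ds i j < coord ds i' j'" if "i < i'" "j < ds i" for i j i' j'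
    using coord_less[of i i' j ds] that by (simp add: coord_def)
  from this[of i i' j j'] this[of i' i j' j] show ?thesis
    using assms by (cases i i' rule: linorder_cases) (auto simp: coord_def)
qed

lemma coord_exhaust:
  assumes "u < (\<Sum>l<k. ds l)"
  obtains i j where "i < k" "j < ds i" "u = coord ds i j"
proof -
  have "\<exists>i<k. \<exists>j<ds i. u = coord ds i j" using assms
  proof (induction k)
    case (Suc k)
    show ?case
    proof (cases "u < (\<Sum>l<k. ds l)")
      case True
      then show ?thesis using Suc.IH by (meson less_SucI)
    next
      case False
      then show ?thesis using Suc.prems
        by (intro exI[of _ k] conjI exI[of _ "u - (\<Sum>l<k. ds l)"]) (auto simp: coord_def)
    qed
  qed simp
  then show ?thesis using that by blast
qed

text \<open>Jordan matrices are built recursively by splitting off the first block; these equations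
  follow that recursion on the index side.\<close>

lemma coord_0: "coord ds 0 j = j"
  and coord_Suc: "coord ds (Suc i) j = ds 0 + coord (\<lambda>i. ds (Suc i)) i j"
  by (simp_all only: coord_def sum.lessThan_Suc_shift) simp_all

lemma jordan_form_carrier:
  "jordan_form k ds rho lam \<in> carrier_mat (\<Sum>l<k. ds l) (\<Sum>l<k. ds l)"
proof -
  have "sum_list (map fst (map (\<lambda>i. (ds i, complex_of_real (rho i) * lam i)) [0..<k])) = (\<Sum>l<k. ds l)"
    by (induction k) simp_all
  then show ?thesis unfolding jordan_form_def by (metis jordan_matrix_carrier)
qed

lemma jordan_form_Suc:
  "jordan_form (Suc k) ds rho lam =
    (let B = jordan_form k (\<lambda>i. ds (Suc i)) (\<lambda>i. rho (Suc i)) (\<lambda>i. lam (Suc i)) in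
     four_block_mat (jordan_block (ds 0) (complex_of_real (rho 0) * lam 0))
       (0\<^sub>m (ds 0) (dim_col B)) (0\<^sub>m (dim_row B) (ds 0)) B)"
proof -
  have "[0..<Suc k] = 0 # map Suc [0..<k]" by (simp add: upt_conv_Cons map_Suc_upt del: upt_Suc)
  then show ?thesis unfolding jordan_form_def jordan_matrix_def
    by (simp add: Let_def comp_def jordan_block_def del: upt_Suc)
qed

lemma jordan_form_index:
  assumes "i < k" "j < ds i" "i' < k" "j' < ds i'"
  shows "jordan_form k ds rho lam $$ (coord ds i j, coord ds i' j') =
    (if i = i' then if j = j' then complex_of_real (rho i) * lam i else if j' = Suc j then 1 else 0
     else 0)"
  using assms
proof (induction k arbitrary: ds rho lam i i')
  case (Suc k)
  let ?B = "jordan_form k (\<lambda>i. ds (Suc i)) (\<lambda>i. rho (Suc i)) (\<lambda>i. lam (Suc i))"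
  let ?n = "\<Sum>l<k. ds (Suc l)"
  have B: "dim_row ?B = ?n" "dim_col ?B = ?n"
    using jordan_form_carrier[of k "\<lambda>i. ds (Suc i)"] by auto
  have less: "coord (\<lambda>i. ds (Suc i)) l m < ?n" if "l < k" "m < ds (Suc l)" for l m
    using coord_less[of l k m "\<lambda>i. ds (Suc i)"] that by simp
  show ?case
  proof (cases i; cases i')
    fix l l' assume "i = Suc l" "i' = Suc l'"
    then show ?thesis
      using Suc.prems less[of l j] less[of l' j'] Suc.IH[of l "\<lambda>i. ds (Suc i)" l']
      by (simp add: jordan_form_Suc Let_def coord_Suc B)
  next
    fix l assume "i = Suc l" "i' = 0"
    then show ?thesis
      using Suc.prems less[of l j] by (simp add: jordan_form_Suc Let_def coord_Suc coord_0 B)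
  next
    fix l' assume "i = 0" "i' = Suc l'"
    then show ?thesis
      using Suc.prems less[of l' j'] by (simp add: jordan_form_Suc Let_def coord_Suc coord_0 B)
  next
    assume "i = 0" "i' = 0"
    then show ?thesis
      using Suc.prems by (simp add: jordan_form_Suc Let_def coord_0 B)
  qed
qed simp

lemma jordan_form_mult_vec:
  assumes w: "w \<in> carrier_vec (\<Sum>l<k. ds l)" and ij: "i < k" "j < ds i"
  shows "(jordan_form k ds rho lam *\<^sub>v w) $ coord ds i j =
    complex_of_real (rho i) * lam i * w $ coord ds i j +
    (if Suc j < ds i then w $ coord ds i (Suc j) else 0)"
proof -
  let ?J = "jordan_form k ds rho lam"
  have "(?J *\<^sub>v w) $ coord ds i j = (\<Sum>u<(\<Sum>l<k. ds l). ?J $$ (coord ds i j, u) * w $ u)"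
    using w jordan_form_carrier[of k ds rho lam] coord_less[OF ij(1), of j ds] ij(2)
    by (simp add: scalar_prod_def lessThan_atLeast0)
  also have "\<dots> = (\<Sum>i'<k. \<Sum>j'<ds i'. ?J $$ (coord ds i j, coord ds i' j') * w $ coord ds i' j')"
    by (rule sum_coord)
  also have "\<dots> = (\<Sum>i'<k. if i' = i then \<Sum>j'<ds i.
      (if j' = j then complex_of_real (rho i) * lam i * w $ coord ds i j else 0) +
      (if j' = Suc j then w $ coord ds i (Suc j) else 0) else 0)"
    using ij by (intro sum.cong refl) (auto simp: jordan_form_index intro!: sum.cong)
  also have "\<dots> = (\<Sum>j'<ds i.
      (if j' = j then complex_of_real (rho i) * lam i * w $ coord ds i j else 0) +
      (if j' = Suc j then w $ coord ds i (Suc j) else 0))"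
    using ij by (simp add: sum.delta)
  \<comment> \<open>In the last row of the block, \<open>Suc j\<close> lies outside the summation
    range, hence the case distinction.\<close>
  also have "\<dots> = complex_of_real (rho i) * lam i * w $ coord ds i j +
    (if Suc j < ds i then w $ coord ds i (Suc j) else 0)"
    using ij unfolding sum.distrib by (simp add: sum.delta)
  finally show ?thesis .
qed

text \<open>An empty block would contribute the factor 1, so positive sizes make every listed
  eigenvalue a root.\<close>

lemma poly_char_poly_jordan_form:
  assumes "\<And>i. i < k \<Longrightarrow> ds i > 0"
  shows "poly (char_poly (jordan_form k ds rho lam)) z = 0 \<longleftrightarrow>
    (\<exists>i<k. z = complex_of_real (rho i) * lam i)"
proof -
  have "poly (char_poly (jordan_form k ds rho lam)) z =
      (\<Prod>i\<leftarrow>[0..<k]. (z - complex_of_real (rho i) * lam i) ^ ds i)"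
    unfolding jordan_form_def jordan_matrix_char_poly poly_prod_list
    by (simp add: comp_def)
  also have "\<dots> = 0 \<longleftrightarrow> (\<exists>i<k. (z - complex_of_real (rho i) * lam i) ^ ds i = 0)"
    by (auto simp: prod_list_zero_iff)
  also have "\<dots> \<longleftrightarrow> (\<exists>i<k. z = complex_of_real (rho i) * lam i)"
    using assms by auto
  finally show ?thesis .
qed

text \<open>Pascal's rule splits each binomial of \<open>s + 1\<close>; the terms with lowered index
  form the polynomial of the next row divided by the eigenvalue. In the last row that polynomial is
  an empty sum.\<close>

lemma Qpoly_add_1:
  assumes "j < ds i" "rho i \<noteq> 0" "lam i \<noteq> 0"
  shows "complex_of_real (rho i) * lam i * Qpoly ds rho lam x' i j (s + 1) =
    complex_of_real (rho i) * lam i * Qpoly ds rho lam x' i j s + Qpoly ds rho lam x' i (Suc j) s"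
proof -
  define \<mu> where "\<mu> = complex_of_real (rho i) * lam i"
  have \<mu>: "\<mu> \<noteq> 0" using assms by (simp add: \<mu>_def)
  obtain n where n: "ds i - j = Suc n" "ds i - Suc j = n" using assms(1)
    by (metis Suc_diff_Suc)
  have \<mu>': "\<mu> powi (- int (Suc c)) = \<mu> powi (- int c) / \<mu>" for c
    unfolding power_int_minus power_int_of_nat by (simp add: divide_inverse mult.commute)
  have "Qpoly ds rho lam x' i j (s + 1) = x' $ coord ds i j + (\<Sum>c<n. complex_of_real
      (s + 1 gchoose Suc c) * \<mu> powi (- int (Suc c)) * x' $ coord ds i (j + Suc c))"
    unfolding Qpoly_def n \<mu>_def[symmetric] sum.lessThan_Suc_shift by simp
  also have "(\<Sum>c<n. complex_of_real
      (s + 1 gchoose Suc c) * \<mu> powi (- int (Suc c)) * x' $ coord ds i (j + Suc c)) =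
      (\<Sum>c<n. complex_of_real
      (s gchoose Suc c) * \<mu> powi (- int (Suc c)) * x' $ coord ds i (j + Suc c)) +
      (\<Sum>c<n. complex_of_real
      (s gchoose c) * \<mu> powi (- int (Suc c)) * x' $ coord ds i (j + Suc c))"
    unfolding gbinomial_Suc_Suc sum.distrib[symmetric] by (simp add: algebra_simps)
  also have "(\<Sum>c<n. complex_of_real
      (s gchoose c) * \<mu> powi (- int (Suc c)) * x' $ coord ds i (j + Suc c)) =
      Qpoly ds rho lam x' i (Suc j) s / \<mu>"
    unfolding Qpoly_def n \<mu>_def[symmetric] \<mu>' sum_divide_distrib by simp
  also have "x' $ coord ds i j + ((\<Sum>c<n. complex_of_real
      (s gchoose Suc c) * \<mu> powi (- int (Suc c)) * x' $ coord ds i (j + Suc c)) +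
      Qpoly ds rho lam x' i (Suc j) s / \<mu>) =
      Qpoly ds rho lam x' i j s + Qpoly ds rho lam x' i (Suc j) s / \<mu>"
    unfolding Qpoly_def n(1) \<mu>_def[symmetric] sum.lessThan_Suc_shift by simp
  finally show ?thesis using \<mu> unfolding \<mu>_def[symmetric] by (simp add: field_simps)
qed

lemma Qpoly_0:
  assumes "j < ds i"
  shows "Qpoly ds rho lam x' i j 0 = x' $ coord ds i j"
proof -
  obtain n where n: "ds i - j = Suc n" using assms by (metis Suc_diff_Suc)
  show ?thesis unfolding Qpoly_def n sum.lessThan_Suc_shift by simp
qed

text \<open>A cone point in terms of \<open>s = log t\<close>, so that the power of \<open>t\<close>
  in block \<open>i\<close> is \<open>rho i powr s\<close>. \<open>THE\<close> recovers the pair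
  \<open>(i, j)\<close> from the flat index; it is well defined as \<open>coord\<close> is injective
  on valid pairs.\<close>

definition cone_vec ::
  "nat \<Rightarrow> (nat \<Rightarrow> nat) \<Rightarrow> (nat \<Rightarrow> real) \<Rightarrow> (nat \<Rightarrow> complex) \<Rightarrow> complex vec \<Rightarrow> (nat \<Rightarrow> complex) \<Rightarrow>
   real \<Rightarrow> complex vec" where
  "cone_vec k ds rho lam x' p s = vec (\<Sum>l<k. ds l) (\<lambda>u. THE z. \<forall>i<k. \<forall>j<ds i. u = coord ds i j \<longrightarrow>
     z = complex_of_real (rho i powr s) * p i * Qpoly ds rho lam x' i j s)"

lemma cone_vec_carrier: "cone_vec k ds rho lam x' p s \<in> carrier_vec (\<Sum>l<k. ds l)"
  by (simp add: cone_vec_def)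

lemma cone_vec_index:
  assumes "i < k" "j < ds i"
  shows "cone_vec k ds rho lam x' p s $ coord ds i j =
    complex_of_real (rho i powr s) * p i * Qpoly ds rho lam x' i j s"
proof -
  let ?z = "complex_of_real (rho i powr s) * p i * Qpoly ds rho lam x' i j s"
  have "(THE z. \<forall>i'<k. \<forall>j'<ds i'. coord ds i j = coord ds i' j' \<longrightarrow>
     z = complex_of_real (rho i' powr s) * p i' * Qpoly ds rho lam x' i' j' s) = ?z"
  proof (rule the_equality)
    show "\<forall>i'<k. \<forall>j'<ds i'. coord ds i j = coord ds i' j' \<longrightarrow>
     ?z = complex_of_real (rho i' powr s) * p i' * Qpoly ds rho lam x' i' j' s"
      using coord_inject[of j ds i] assms by auto
  qed (use assms in blast)
  then show ?thesis unfolding cone_vec_def using coord_less[of i k j ds, OF assms] by simp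
qed

lemma vec_eq_coordI:
  assumes "v \<in> carrier_vec (\<Sum>l<k. ds l)" "w \<in> carrier_vec (\<Sum>l<k. ds l)"
    and "\<And>i j. i < k \<Longrightarrow> j < ds i \<Longrightarrow> v $ coord ds i j = w $ coord ds i j"
  shows "v = w"
proof (rule eq_vecI)
  fix u assume "u < dim_vec w"
  then have "u < (\<Sum>l<k. ds l)" using assms(2) by simp
  then show "v $ u = w $ u" using assms(3) by (metis coord_exhaust)
qed (use assms in simp)

lemma jordan_form_mult_cone_vec:
  assumes "\<And>i. i < k \<Longrightarrow> rho i > 0" "\<And>i. i < k \<Longrightarrow> lam i \<noteq> 0"
  shows "jordan_form k ds rho lam *\<^sub>v cone_vec k ds rho lam x' p s =
    cone_vec k ds rho lam x' (\<lambda>i. lam i * p i) (s + 1)"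
proof (rule vec_eq_coordI)
  fix i j assume ij: "i < k" "j < ds i"
  \<comment> \<open>For \<open>Suc j = ds i\<close> the right-hand \<open>Qpoly\<close> is an empty
    sum, matching the missing superdiagonal entry.\<close>
  have "(if Suc j < ds i then cone_vec k ds rho lam x' p s $ coord ds i (Suc j) else 0) =
      complex_of_real (rho i powr s) * p i * Qpoly ds rho lam x' i (Suc j) s"
    using ij by (auto simp: cone_vec_index Qpoly_def)
  then have "(jordan_form k ds rho lam *\<^sub>v cone_vec k ds rho lam x' p s) $ coord ds i j =
    complex_of_real (rho i powr s) * p i * (complex_of_real (rho i) * lam i *
     Qpoly ds rho lam x' i j s + Qpoly ds rho lam x' i (Suc j) s)"
    using ij by (simp add: jordan_form_mult_vec cone_vec_carrier cone_vec_index algebra_simps)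
  also have "complex_of_real (rho i) * lam i *
     Qpoly ds rho lam x' i j s + Qpoly ds rho lam x' i (Suc j) s =
     complex_of_real (rho i) * lam i * Qpoly ds rho lam x' i j (s + 1)"
    using Qpoly_add_1[of j ds i rho lam x' s] assms[of i] ij by simp
  finally show "(jordan_form k ds rho lam *\<^sub>v cone_vec k ds rho lam x' p s) $ coord ds i j =
      cone_vec k ds rho lam x' (\<lambda>i. lam i * p i) (s + 1) $ coord ds i j"
    using ij assms(1)[of i] by (simp add: cone_vec_index powr_add)
qed (auto simp: cone_vec_carrier intro!: mult_mat_vec_carrier[OF jordan_form_carrier])

lemma cone_vec_0:
  assumes "x' \<in> carrier_vec (\<Sum>l<k. ds l)" "\<And>i. i < k \<Longrightarrow> rho i > 0"
  shows "cone_vec k ds rho lam x' (\<lambda>_. 1) 0 = x'"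
  by (rule vec_eq_coordI[OF cone_vec_carrier assms(1)])
    (use assms(2) in \<open>auto simp: cone_vec_index Qpoly_0 less_le\<close>)

text \<open>The substitution \<open>t = rho (k - 1) powr s\<close> reaches all positive
  \<open>t\<close> because the base exceeds 1, and it turns the exponent
  \<open>log (rho (k - 1)) (rho i)\<close> into a change of base.\<close>

lemma trajectory_cone_eq:
  assumes rho: "\<And>i. i < k \<Longrightarrow> rho i > 0" and last: "rho (k - 1) > 1" and t0: "t0 > 0"
  shows "trajectory_cone k ds rho lam x' t0 =
    {cone_vec k ds rho lam x' (($) p) s |p s. p \<in> torus k lam \<and> rho (k - 1) powr s \<ge> t0}"
proof -
  have powr: "(rho (k - 1) powr s) powr log (rho (k - 1)) (rho i) = rho i powr s" if "i < k" for i s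
  proof -
    have "(rho (k - 1) powr s) powr log (rho (k - 1)) (rho i) =
        (rho (k - 1) powr log (rho (k - 1)) (rho i)) powr s"
      by (simp add: powr_powr mult.commute)
    then show ?thesis using rho[OF that] last by simp
  qed
  have "y \<in> ray k ds rho lam x' p t0 \<longleftrightarrow>
     (\<exists>s. rho (k - 1) powr s \<ge> t0 \<and> y = cone_vec k ds rho lam x' (($) p) s)" for y p
  proof
    assume "y \<in> ray k ds rho lam x' p t0"
    then obtain t where y: "y \<in> carrier_vec (\<Sum>i<k. ds i)" and t: "t \<ge> t0"
      "\<And>i j. i < k \<Longrightarrow> j < ds i \<Longrightarrow> y $ coord ds i j =
          complex_of_real (t powr log (rho (k - 1)) (rho i)) * p $ i *
          Qpoly ds rho lam x' i j (log (rho (k - 1)) t)"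
      unfolding ray_def by blast
    let ?s = "log (rho (k - 1)) t"
    have s: "rho (k - 1) powr ?s = t" using last t t0 by simp
    have "y = cone_vec k ds rho lam x' (($) p) ?s"
    proof (rule vec_eq_coordI[OF y cone_vec_carrier])
      fix i j assume ij: "i < k" "j < ds i"
      show "y $ coord ds i j = cone_vec k ds rho lam x' (($) p) ?s $ coord ds i j"
        unfolding t(2)[OF ij] cone_vec_index[of i k j ds, OF ij] powr[OF ij(1), of ?s, unfolded s] ..
    qed
    then show "\<exists>s. rho (k - 1) powr s \<ge> t0 \<and> y = cone_vec k ds rho lam x' (($) p) s"
      using s t by (intro exI[of _ ?s]) simp
  next
    assume "\<exists>s. rho (k - 1) powr s \<ge> t0 \<and> y = cone_vec k ds rho lam x' (($) p) s"
    then obtain s where s: "rho (k - 1) powr s \<ge> t0" "y = cone_vec k ds rho lam x' (($) p) s" by blast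
    then show "y \<in> ray k ds rho lam x' p t0"
      unfolding ray_def using last
      by (auto simp: cone_vec_carrier cone_vec_index powr powr[unfolded One_nat_def]
          intro!: exI[of _ "rho (k - 1) powr s"])
  qed
  then show ?thesis unfolding trajectory_cone_def by blast
qed

subsection \<open>The torus\<close>

lemma of_real_of_rat: "of_real (of_rat q) = (of_rat q :: 'a :: {real_field, field_char_0})"
  by (cases q) (simp add: of_rat_rat)

text \<open>Writing the exponent as a sum keeps the case \<open>i = j\<close> valid, which occurs
  when a real eigenvalue is paired with its conjugate.\<close>

lemma prod_powi_pair:
  fixes z :: "nat \<Rightarrow> complex"
  assumes "\<And>l. l < k \<Longrightarrow> z l \<noteq> 0" "i < k" "j < k"
  shows "(\<Prod>l<k. z l powi ((if l = i then a else 0) + (if l = j then b else 0))) = z i powi a * z j powi b"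
proof -
  have "(\<Prod>l<k. z l powi ((if l = i then a else 0) + (if l = j then b else 0))) =
      (\<Prod>l<k. (if l = i then z i powi a else 1) * (if l = j then z j powi b else 1))"
    using assms(1) by (intro prod.cong refl) (auto simp: power_int_add)
  also have "\<dots> = z i powi a * z j powi b"
    using assms(2,3) by (simp add: prod.distrib prod.delta)
  finally show ?thesis .
qed

lemma torus_nonzero: "p \<in> torus k lam \<Longrightarrow> i < k \<Longrightarrow> p $ i \<noteq> 0"
  unfolding torus_def by auto

text \<open>A relation between two entries of \<open>lam\<close> is an element of
  \<open>mult_relations\<close> with at most two nonzero coordinates. It is used with exponents
  \<open>(1, -1)\<close> for equal and \<open>(1, 1)\<close> for conjugate entries.\<close>

lemma torus_pair_relation:
  assumes p: "p \<in> torus k lam" and lam: "\<And>i. i < k \<Longrightarrow> cmod (lam i) = 1" and ij: "i < k" "j < k"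
    and rel: "lam i powi a * lam j powi b = 1"
  shows "p $ i powi a * p $ j powi b = 1"
proof -
  let ?v = "vec k (\<lambda>l. (if l = i then a else 0) + (if l = j then b else 0))"
  have "lam l \<noteq> 0" if "l < k" for l using lam[OF that] by auto
  then have "?v \<in> mult_relations k lam"
    unfolding mult_relations_def using prod_powi_pair[of k lam i j a b] ij rel by simp
  then have "(\<Prod>l<k. p $ l powi (?v $ l)) = 1" using p unfolding torus_def by blast
  then show ?thesis using prod_powi_pair[of k "($) p" i j a b] ij torus_nonzero[OF p] by simp
qed

lemma torus_eq:
  assumes "p \<in> torus k lam" "\<And>i. i < k \<Longrightarrow> cmod (lam i) = 1" "i < k" "j < k" "lam i = lam j"
  shows "p $ i = p $ j"
proof -
  have "lam j \<noteq> 0" using assms(2)[OF assms(4)] by auto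
  then have "p $ i powi 1 * p $ j powi (- 1) = 1"
    using assms(2) by (intro torus_pair_relation[OF assms(1) _ assms(3,4)])
      (simp_all add: assms(5) power_int_minus)
  then show ?thesis using torus_nonzero[OF assms(1,4)] by (simp add: power_int_minus field_simps)
qed

text \<open>On the unit circle the conjugate is the inverse, so the hypothesis amounts to
  \<open>lam i * lam j = 1\<close>.\<close>

lemma torus_cnj:
  assumes "p \<in> torus k lam" "\<And>i. i < k \<Longrightarrow> cmod (lam i) = 1" "i < k" "j < k" "lam i = cnj (lam j)"
  shows "p $ i = cnj (p $ j)"
proof -
  have "p $ i powi 1 * p $ j powi 1 = 1"
    using assms(2) assms(2)[OF assms(4)] complex_norm_square[of "lam j"]
    by (intro torus_pair_relation[OF assms(1) _ assms(3,4)]) (simp_all add: assms(5) mult.commute)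
  moreover have "p $ j * cnj (p $ j) = 1"
    using assms(1,4) complex_norm_square[of "p $ j"] unfolding torus_def by simp
  ultimately have "p $ i * p $ j = cnj (p $ j) * p $ j" by (simp add: mult.commute)
  then show ?thesis using torus_nonzero[OF assms(1,4)] by simp
qed

lemma torus_mult:
  assumes "p \<in> torus k lam" "\<And>i. i < k \<Longrightarrow> cmod (lam i) = 1"
  shows "vec k (\<lambda>i. lam i * p $ i) \<in> torus k lam"
  using assms unfolding torus_def mult_relations_def
  by (auto simp: norm_mult power_int_mult_distrib prod.distrib)

lemma torus_power:
  assumes "\<And>i. i < k \<Longrightarrow> cmod (lam i) = 1"
  shows "vec k (\<lambda>i. lam i ^ n) \<in> torus k lam"
proof (induction n)
  case 0
  then show ?case by (auto simp: torus_def)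
next
  case (Suc n)
  from torus_mult[OF this assms]
  have "vec k (\<lambda>i. lam i * vec k (\<lambda>i. lam i ^ n) $ i) \<in> torus k lam" by simp
  also have "vec k (\<lambda>i. lam i * vec k (\<lambda>i. lam i ^ n) $ i) = vec k (\<lambda>i. lam i ^ Suc n)"
    by (intro eq_vecI) auto
  finally show ?case .
qed

lemma torus_finitely_many_relations:
  assumes lam: "\<And>i. i < k \<Longrightarrow> cmod (lam i) = 1"
  obtains V :: "(nat \<Rightarrow> int) set" where "finite V"
    "\<And>p. vec k p \<in> torus k lam \<longleftrightarrow>
       (\<forall>i<k. cmod (p i) = 1) \<and> (\<forall>v\<in>V. (\<Prod>i<k. p i powi v i) = 1)"
proof -
  \<comment> \<open>Relations are extended by zero from \<open>k\<close> on, so that integer vectors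
    become functions of bounded support.\<close>
  let ?H = "{a. (\<forall>i\<ge>k. a i = 0) \<and> (\<Prod>i<k. lam i powi a i) = 1}"
  have quot: "(\<Prod>i<k. z i powi (a i - b i)) = 1"
    if z: "\<And>i. i < k \<Longrightarrow> cmod (z i) = 1" and "(\<Prod>i<k. z i powi a i) = 1" "(\<Prod>i<k. z i powi b i) = 1"
    for z and a b :: "nat \<Rightarrow> int"
  proof -
    have "z i \<noteq> 0" if "i < k" for i using z[OF that] by auto
    then have "(\<Prod>i<k. z i powi (a i - b i)) = (\<Prod>i<k. z i powi a i / z i powi b i)"
      by (intro prod.cong refl) (simp add: power_int_diff)
    then show ?thesis using that(2,3) by (simp add: prod_dividef)
  qed
  have "\<exists>S. finite S \<and> S \<subseteq> ?H \<and> (\<forall>H'. S \<subseteq> H' \<longrightarrow> (\<lambda>_. 0) \<in> H' \<longrightarrow>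
           (\<forall>a\<in>H'. \<forall>b\<in>H'. (\<lambda>i. a i - b i) \<in> H') \<longrightarrow> ?H \<subseteq> H')"
  proof (rule int_lattice_finitely_generated)
    show "(\<lambda>i. a i - b i) \<in> ?H" if "a \<in> ?H" "b \<in> ?H" for a b
      using that quot[of lam a b] lam by simp
  qed auto
  then obtain V where V: "finite V" "V \<subseteq> ?H" and gen: "\<forall>H'. V \<subseteq> H' \<longrightarrow> (\<lambda>_. 0) \<in> H' \<longrightarrow>
           (\<forall>a\<in>H'. \<forall>b\<in>H'. (\<lambda>i. a i - b i) \<in> H') \<longrightarrow> ?H \<subseteq> H'"
    by (elim exE conjE)
  show ?thesis
  proof (rule that[OF V(1)])
    fix p
    show "vec k p \<in> torus k lam \<longleftrightarrow>
       (\<forall>i<k. cmod (p i) = 1) \<and> (\<forall>v\<in>V. (\<Prod>i<k. p i powi v i) = 1)"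
    proof
      assume p: "vec k p \<in> torus k lam"
      have "(\<Prod>i<k. p i powi v i) = 1" if "v \<in> V" for v
      proof -
        have "vec k v \<in> mult_relations k lam" using V(2) that by (auto simp: mult_relations_def)
        then have "(\<Prod>i<k. (vec k p $ i) powi (vec k v $ i)) = 1" using p unfolding torus_def by blast
        then show ?thesis by simp
      qed
      then show "(\<forall>i<k. cmod (p i) = 1) \<and> (\<forall>v\<in>V. (\<Prod>i<k. p i powi v i) = 1)"
        using p by (auto simp: torus_def)
    next
      assume p: "(\<forall>i<k. cmod (p i) = 1) \<and> (\<forall>v\<in>V. (\<Prod>i<k. p i powi v i) = 1)"
      \<comment> \<open>The exponents of all relations satisfied by \<open>p\<close> form a
        difference-closed set containing the generators \<open>V\<close>, hence all of
        \<open>?H\<close>.\<close>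
      have sub: "?H \<subseteq> {a. (\<Prod>i<k. p i powi a i) = 1}"
        by (rule gen[rule_format]) (use p quot[of p] in auto)
      have "(\<Prod>i<k. p i powi (v $ i)) = 1" if "v \<in> mult_relations k lam" for v
      proof -
        have eq: "(\<Prod>i<k. z i powi (if i < k then v $ i else 0)) = (\<Prod>i<k. z i powi (v $ i))"
          for z :: "nat \<Rightarrow> complex" by (intro prod.cong) auto
        have "(\<lambda>i. if i < k then v $ i else 0) \<in> ?H"
          using that by (simp add: eq mult_relations_def)
        from subsetD[OF sub this] show ?thesis by (simp add: eq)
      qed
      then show "vec k p \<in> torus k lam" using p by (simp add: torus_def)
    qed
  qed
qed

lemma cone_vec_cong:
  "(\<And>i. i < k \<Longrightarrow> p i = q i) \<Longrightarrow> cone_vec k ds rho lam x' p s = cone_vec k ds rho lam x' q s"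
  by (rule vec_eq_coordI[OF cone_vec_carrier cone_vec_carrier]) (simp add: cone_vec_index)

subsection \<open>The trajectory cone of a rational matrix\<close>

locale jordan_orbit =
  fixes d k :: nat and A :: "rat mat" and x :: "rat vec" and P Pinv :: "complex mat"
    and ds :: "nat \<Rightarrow> nat" and rho :: "nat \<Rightarrow> real" and lam :: "nat \<Rightarrow> complex"
  assumes A: "A \<in> carrier_mat d d" and x: "x \<in> carrier_vec d"
    and ds: "\<And>i. i < k \<Longrightarrow> ds i > 0"
    and rho: "\<And>i. i < k \<Longrightarrow> rho i > 0"
    and lam: "\<And>i. i < k \<Longrightarrow> cmod (lam i) = 1"
    and jordan: "similar_mat_wit (map_mat of_rat A) (jordan_form k ds rho lam) P Pinv"
begin

definition x' :: "complex vec" where "x' = Pinv *\<^sub>v map_vec of_rat x"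

definition w :: "(nat \<Rightarrow> complex) \<Rightarrow> real \<Rightarrow> complex vec" where
  "w p s = cone_vec k ds rho lam x' p s"

definition mu :: "nat \<Rightarrow> complex" where "mu i = complex_of_real (rho i) * lam i"

definition orbit :: "nat \<Rightarrow> complex vec" where "orbit n = map_vec of_rat (A ^\<^sub>m n *\<^sub>v x)"

lemma sum_ds: "(\<Sum>l<k. ds l) = d"
  and P: "P \<in> carrier_mat d d" and Pinv: "Pinv \<in> carrier_mat d d"
  and P_Pinv: "P * Pinv = 1\<^sub>m d" and Pinv_P: "Pinv * P = 1\<^sub>m d"
  and A_eq: "map_mat of_rat A = P * jordan_form k ds rho lam * Pinv"
  and J: "jordan_form k ds rho lam \<in> carrier_mat d d"
proof -
  have "jordan_form k ds rho lam \<in> carrier_mat d d"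
    using jordan A unfolding similar_mat_wit_def Let_def by auto
  then show "(\<Sum>l<k. ds l) = d" "jordan_form k ds rho lam \<in> carrier_mat d d"
    using jordan_form_carrier[of k ds rho lam] by auto
qed (use jordan A in \<open>auto simp: similar_mat_wit_def Let_def\<close>)

lemma lam_nonzero: "i < k \<Longrightarrow> lam i \<noteq> 0"
  using lam[of i] by auto

lemma mu_nonzero: "i < k \<Longrightarrow> mu i \<noteq> 0"
  using lam_nonzero rho[of i] by (auto simp: mu_def)

lemma cmod_mu: "i < k \<Longrightarrow> cmod (mu i) = rho i"
  using lam[of i] rho[of i] by (simp add: mu_def norm_mult)

text \<open>\<open>lam i\<close> is a function of the eigenvalue that commutes with conjugation, so
  equal or conjugate eigenvalues have equal or conjugate \<open>lam\<close>.\<close>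

lemma lam_eq: "i < k \<Longrightarrow> lam i = mu i / complex_of_real (cmod (mu i))"
  using rho[of i] cmod_mu[of i] by (simp add: mu_def)

lemma w_carrier: "w p s \<in> carrier_vec d"
  unfolding w_def using cone_vec_carrier[of k ds] by (simp add: sum_ds)

lemma A_mult_w: "map_mat of_rat A *\<^sub>v (P *\<^sub>v w p s) = P *\<^sub>v w (\<lambda>i. lam i * p i) (s + 1)"
proof -
  have "map_mat of_rat A *\<^sub>v (P *\<^sub>v w p s) = P *\<^sub>v (jordan_form k ds rho lam *\<^sub>v ((Pinv * P) *\<^sub>v w p s))"
    unfolding A_eq using P Pinv J w_carrier[of p s]
    by (simp add: assoc_mult_mat_vec[of _ d d _ d])
  then show ?thesis
    unfolding Pinv_P w_def
    using jordan_form_mult_cone_vec[of k rho lam ds x' p s] rho lam_nonzero w_carrier[unfolded w_def]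
    by simp
qed

lemma A_mult_orbit: "map_mat of_rat A *\<^sub>v orbit n = orbit (Suc n)"
proof -
  have "A * A ^\<^sub>m n = A ^\<^sub>m n * A"
  proof (induction n)
    case (Suc n)
    have "A * (A ^\<^sub>m n * A) = A * A ^\<^sub>m n * A"
      using A by (intro assoc_mult_mat[symmetric, of _ d d _ d _ d]) auto
    then show ?case using Suc by simp
  qed (use A in simp)
  then have "A *\<^sub>v (A ^\<^sub>m n *\<^sub>v x) = A ^\<^sub>m Suc n *\<^sub>v x"
    using A x by (simp add: assoc_mult_mat_vec[of _ d d _ d, symmetric])
  then show ?thesis
    unfolding orbit_def using A x
    by (subst of_rat_hom.mult_mat_vec_hom[symmetric, of _ d d])
      (auto intro!: mult_mat_vec_carrier[of _ d d])
qed

text \<open>Starting from \<open>x'\<close> at \<open>p = 1\<close>, \<open>s = 0\<close>, each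
  application of \<open>A\<close> advances both parameters. This serves twice: it puts late orbit
  points on the cone, and it expresses the constants of the cone through rational vectors.\<close>

lemma orbit_eq: "orbit n = P *\<^sub>v w (\<lambda>i. lam i ^ n) (real n)"
proof (induction n)
  case 0
  have x': "x' \<in> carrier_vec d" unfolding x'_def using Pinv x by auto
  have "w (\<lambda>_. 1) 0 = x'"
    unfolding w_def by (rule cone_vec_0) (use x' rho sum_ds in auto)
  moreover have "P *\<^sub>v x' = (P * Pinv) *\<^sub>v map_vec of_rat x"
    unfolding x'_def using P Pinv x by (simp add: assoc_mult_mat_vec[of _ d d _ d])
  ultimately show ?case unfolding orbit_def P_Pinv using A x by simp
next
  case (Suc n)
  then show ?case using A_mult_w[of "\<lambda>i. lam i ^ n" "real n"]
    by (simp add: A_mult_orbit[symmetric] add.commute)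
qed

lemma P_mult_index:
  assumes "u < d" "v \<in> carrier_vec d"
  shows "(P *\<^sub>v v) $ u = (\<Sum>i<k. \<Sum>j<ds i. P $$ (u, coord ds i j) * v $ coord ds i j)"
proof -
  have "(P *\<^sub>v v) $ u = (\<Sum>l<(\<Sum>l<k. ds l). P $$ (u, l) * v $ l)"
    unfolding sum_ds using P assms by (simp add: scalar_prod_def lessThan_atLeast0)
  then show ?thesis unfolding sum_coord .
qed

section \<open>The spectrum and constants independent of the Jordan basis\<close>

definition spec :: "complex set" where "spec = mu ` {..<k}"

text \<open>Similarity to the Jordan form makes \<open>spec\<close> the root set of a polynomial
  with rational coefficients; its symmetry under conjugation and the definability of its elements
  rest on this.\<close>

lemma root_iff: "poly (char_poly (map_mat of_rat A)) z = 0 \<longleftrightarrow> z \<in> spec"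
proof -
  have "similar_mat (map_mat of_rat A) (jordan_form k ds rho lam)"
    using jordan unfolding similar_mat_def by blast
  then have "char_poly (map_mat of_rat A) = char_poly (jordan_form k ds rho lam)"
    by (rule char_poly_similar)
  then show ?thesis using poly_char_poly_jordan_form[of k ds rho lam z] ds
    by (auto simp: spec_def mu_def)
qed

lemma coeff_char_poly: "coeff (char_poly (map_mat of_rat A)) n = of_rat (coeff (char_poly A) n)"
  unfolding of_rat_hom.char_poly_hom[OF A] by (simp add: coeff_map_poly)

lemma cnj_of_rat: "cnj (of_rat q) = of_rat q"
  by (metis complex_cnj_complex_of_real of_real_of_rat)

lemma cnj_spec: "cnj ` spec = spec"
proof -
  have "cnj z \<in> spec" if "z \<in> spec" for z
  proof -
    have "poly (char_poly (map_mat of_rat A)) (cnj z) = cnj (poly (char_poly (map_mat of_rat A)) z)"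
      by (simp add: poly_altdef coeff_char_poly cnj_of_rat)
    then show ?thesis using that unfolding root_iff[symmetric] by simp
  qed
  then show ?thesis by (auto intro!: image_eqI[of _ cnj "cnj z" for z])
qed

lemma cfo_fun_spec:
  assumes "z \<in> spec"
  shows "cfo_fun (\<lambda>_. z)"
proof (rule cfo_fun_const_root)
  show "poly (char_poly (map_mat of_rat A)) z = 0" using assms root_iff by simp
  show "char_poly (map_mat of_rat A) \<noteq> (0 :: complex poly)"
    using degree_monic_char_poly[of "map_mat of_rat A :: complex mat" d] A by auto
qed (simp add: coeff_char_poly cfo_fun_of_rat)

text \<open>This is entry \<open>u\<close> of \<open>(A - \<mu>)^m\<close> applied to the generalised \<open>\<mu>\<close>-eigencomponent of \<open>x\<close>,
  in a form that does not mention \<open>P\<close>.\<close>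

definition eigencomp :: "nat \<Rightarrow> complex \<Rightarrow> nat \<Rightarrow> complex" where
  "eigencomp u \<mu> m = (let h = hermite_poly spec d \<mu> m in \<Sum>n\<le>degree h. coeff h n * orbit n $ u)"

lemma orbit_index: "u < d \<Longrightarrow> orbit n $ u = of_rat ((A ^\<^sub>m n *\<^sub>v x) $ u)"
  unfolding orbit_def using A by simp

lemma cfo_fun_eigencomp:
  assumes "u < d" "\<mu> \<in> spec"
  shows "cfo_fun (\<lambda>_. eigencomp u \<mu> m)"
  using fo_poly_hermite_poly[of spec \<mu> d m] assms cfo_fun_spec
  unfolding eigencomp_def Let_def fo_poly_def
  by (auto intro!: cfo_fun_sum cfo_fun_mult cfo_fun_of_rat simp: orbit_index)

text \<open>The orbit is rational and the node set \<open>spec\<close> is closed under conjugation,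
  so only \<open>\<mu>\<close> is affected.\<close>

lemma cnj_eigencomp:
  assumes "u < d"
  shows "cnj (eigencomp u \<mu> m) = eigencomp u (cnj \<mu>) m"
proof -
  have "hermite_poly spec d (cnj \<mu>) m = map_poly cnj (hermite_poly spec d \<mu> m)"
    unfolding map_poly_cnj_hermite_poly cnj_spec ..
  then show ?thesis unfolding eigencomp_def Let_def
    by (simp add: degree_map_poly coeff_map_poly orbit_index assms cnj_of_rat)
qed

text \<open>By \<open>orbit_eq\<close>, each row of each block contributes a sequence of the kind
  treated in \<open>sum_coeff_taylor\<close>.\<close>

lemma sum_coeff_orbit:
  assumes "u < d"
  shows "(\<Sum>n\<le>degree h. coeff h n * orbit n $ u) =
    (\<Sum>i<k. \<Sum>j<ds i. P $$ (u, coord ds i j) *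
       (\<Sum>c<ds i - j. coeff (h \<circ>\<^sub>p [:mu i, 1:]) c * x' $ coord ds i (j + c)))"
proof -
  have "orbit n $ u = (\<Sum>i<k. \<Sum>j<ds i. P $$ (u, coord ds i j) * (mu i ^ n *
      (\<Sum>c<ds i - j. complex_of_real (real n gchoose c) * mu i powi (- int c) * x' $ coord ds i (j + c))))"
    for n
    unfolding orbit_eq P_mult_index[OF assms w_carrier] unfolding w_def
  proof (intro sum.cong refl)
    fix i j assume ij: "i \<in> {..<k}" "j \<in> {..<ds i}"
    have "complex_of_real (rho i powr real n) * lam i ^ n = mu i ^ n"
      using rho[of i] ij by (simp add: powr_realpow mu_def power_mult_distrib)
    then show "P $$ (u, coord ds i j) * cone_vec k ds rho lam x' (\<lambda>i. lam i ^ n) (real n) $ coord ds i j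
      = P $$ (u, coord ds i j) * (mu i ^ n *
      (\<Sum>c<ds i - j. complex_of_real (real n gchoose c) * mu i powi (- int c) * x' $ coord ds i (j + c)))"
      using ij by (simp add: cone_vec_index Qpoly_def mu_def)
  qed
  then have "(\<Sum>n\<le>degree h. coeff h n * orbit n $ u) =
    (\<Sum>n\<le>degree h. \<Sum>i<k. \<Sum>j<ds i. P $$ (u, coord ds i j) * (coeff h n * (mu i ^ n *
      (\<Sum>c<ds i - j. complex_of_real (real n gchoose c) * mu i powi (- int c) * x' $ coord ds i (j + c)))))"
    by (simp add: sum_distrib_left mult_ac)
  also have "\<dots> = (\<Sum>i<k. \<Sum>j<ds i. \<Sum>n\<le>degree h. P $$ (u, coord ds i j) * (coeff h n * (mu i ^ n *
      (\<Sum>c<ds i - j. complex_of_real (real n gchoose c) * mu i powi (- int c) * x' $ coord ds i (j + c)))))"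
    by (subst sum.swap, rule sum.cong[OF refl], rule sum.swap)
  also have "\<dots> = (\<Sum>i<k. \<Sum>j<ds i. P $$ (u, coord ds i j) *
       (\<Sum>c<ds i - j. coeff (h \<circ>\<^sub>p [:mu i, 1:]) c * x' $ coord ds i (j + c)))"
    unfolding sum_distrib_left[symmetric]
    by (intro sum.cong refl) (simp add: sum_coeff_taylor mu_nonzero)
  finally show ?thesis .
qed

text \<open>Entry \<open>u\<close> of the image under \<open>P\<close> of the \<open>m\<close>-th
  power of the nilpotent part of block \<open>i\<close>, applied to the part of \<open>x'\<close> in
  that block.\<close>

definition block_comp :: "nat \<Rightarrow> nat \<Rightarrow> nat \<Rightarrow> complex" where
  "block_comp u i m =
    (\<Sum>j<ds i. P $$ (u, coord ds i j) * (if m < ds i - j then x' $ coord ds i (j + m) else 0))"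

lemma ds_le: "i < k \<Longrightarrow> ds i \<le> d"
  unfolding sum_ds[symmetric] by (intro member_le_sum) auto

text \<open>At each eigenvalue the interpolating polynomial has at most one nonzero Taylor
  coefficient of order below \<open>d\<close>, so only blocks with eigenvalue \<open>\<mu>\<close>
  survive. The summands depend on the Jordan basis, the left-hand side does not.\<close>

lemma eigencomp_eq:
  assumes "u < d"
  shows "eigencomp u \<mu> m = (\<Sum>i | i < k \<and> mu i = \<mu>. block_comp u i m)"
proof -
  have "eigencomp u \<mu> m = (\<Sum>i<k. \<Sum>j<ds i. P $$ (u, coord ds i j) *
      (\<Sum>c<ds i - j. (if mu i = \<mu> \<and> c = m then 1 else 0) * x' $ coord ds i (j + c)))"
    unfolding eigencomp_def Let_def sum_coeff_orbit[OF assms]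
  proof (intro sum.cong refl arg_cong2[where f = "(*)"])
    fix i j c assume "i \<in> {..<k}" "j \<in> {..<ds i}" "c \<in> {..<ds i - j}"
    \<comment> \<open>Blocks have size at most \<open>d\<close>, so all orders that occur are
      controlled by the interpolation.\<close>
    moreover from this have "c < d" using ds_le[of i] by simp
    ultimately show "coeff (hermite_poly spec d \<mu> m \<circ>\<^sub>p [:mu i, 1:]) c =
        (if mu i = \<mu> \<and> c = m then 1 else 0)"
      by (intro taylor_coeff_hermite_poly) (auto simp: spec_def)
  qed
  also have "\<dots> = (\<Sum>i<k. if mu i = \<mu> then block_comp u i m else 0)"
  proof (intro sum.cong refl)
    fix i
    have "(\<Sum>c<n. (if mu i = \<mu> \<and> c = m then 1 else 0) * f c) =
        (if mu i = \<mu> then if m < n then f m else 0 else 0)" for n and f :: "nat \<Rightarrow> complex"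
    proof -
      have "(\<Sum>c<n. (if mu i = \<mu> \<and> c = m then 1 else 0) * f c) =
          (\<Sum>c<n. if c = m then if mu i = \<mu> then f c else 0 else 0)"
        by (intro sum.cong refl) auto
      then show ?thesis by (simp add: sum.delta)
    qed
    then show "(\<Sum>j<ds i. P $$ (u, coord ds i j) *
        (\<Sum>c<ds i - j. (if mu i = \<mu> \<and> c = m then 1 else 0) * x' $ coord ds i (j + c))) =
        (if mu i = \<mu> then block_comp u i m else 0)"
      unfolding block_comp_def by simp
  qed
  also have "\<dots> = (\<Sum>i | i < k \<and> mu i = \<mu>. block_comp u i m)"
    by (subst sum.inter_filter[symmetric]) auto
  finally show ?thesis .
qed

text \<open>The function \<open>\<pi>\<close> says that \<open>p\<close> depends on the eigenvalue
  only; then blocks sharing an eigenvalue have the same factors, and their components add up to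
  \<open>eigencomp\<close>.\<close>

lemma P_mult_w_index:
  assumes u: "u < d" and \<pi>: "\<And>i. i < k \<Longrightarrow> \<pi> (mu i) = p i"
  shows "(P *\<^sub>v w p s) $ u = (\<Sum>\<mu>\<in>spec. complex_of_real (cmod \<mu> powr s) * \<pi> \<mu> *
    (\<Sum>m<d. complex_of_real (s gchoose m) * \<mu> powi (- int m) * eigencomp u \<mu> m))"
proof -
  define g where "g \<mu> m = complex_of_real (cmod \<mu> powr s) * \<pi> \<mu> *
    (complex_of_real (s gchoose m) * \<mu> powi (- int m))" for \<mu> m
  \<comment> \<open>Padding with zeros gives all rows the common range \<open>m < d\<close>, so the
    sums over rows and over \<open>m\<close> can be exchanged.\<close>
  have Q: "Qpoly ds rho lam x' i j s = (\<Sum>m<d. complex_of_real (s gchoose m) * mu i powi (- int m) *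
      (if m < ds i - j then x' $ coord ds i (j + m) else 0))" if "i < k" for i j
    unfolding Qpoly_def mu_def[symmetric] using ds_le[OF that]
    by (intro sum.mono_neutral_cong_left) auto
  have "(P *\<^sub>v w p s) $ u = (\<Sum>i<k. \<Sum>j<ds i. P $$ (u, coord ds i j) * (\<Sum>m<d. g (mu i) m *
      (if m < ds i - j then x' $ coord ds i (j + m) else 0)))"
    unfolding P_mult_index[OF u w_carrier] unfolding w_def
    by (intro sum.cong refl)
      (simp add: cone_vec_index Q g_def \<pi> cmod_mu sum_distrib_left mult.assoc)
  also have "\<dots> = (\<Sum>i<k. \<Sum>m<d. g (mu i) m * block_comp u i m)"
  proof (rule sum.cong[OF refl])
    fix i
    have "(\<Sum>j<ds i. P $$ (u, coord ds i j) * (\<Sum>m<d. g (mu i) m *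
      (if m < ds i - j then x' $ coord ds i (j + m) else 0))) = (\<Sum>j<ds i. \<Sum>m<d. g (mu i) m *
       (P $$ (u, coord ds i j) * (if m < ds i - j then x' $ coord ds i (j + m) else 0)))"
      unfolding sum_distrib_left by (simp add: mult.left_commute)
    also have "\<dots> = (\<Sum>m<d. g (mu i) m * block_comp u i m)"
      unfolding block_comp_def sum_distrib_left by (rule sum.swap)
    finally show "(\<Sum>j<ds i. P $$ (u, coord ds i j) * (\<Sum>m<d. g (mu i) m *
      (if m < ds i - j then x' $ coord ds i (j + m) else 0))) =
      (\<Sum>m<d. g (mu i) m * block_comp u i m)" .
  qed
  also have "\<dots> = (\<Sum>\<mu>\<in>spec. \<Sum>i | i \<in> {..<k} \<and> mu i = \<mu>. \<Sum>m<d. g (mu i) m * block_comp u i m)"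
    by (rule sum.group[symmetric]) (auto simp: spec_def)
  also have "\<dots> = (\<Sum>\<mu>\<in>spec. \<Sum>m<d. g \<mu> m * eigencomp u \<mu> m)"
  proof (rule sum.cong[OF refl])
    fix \<mu>
    have "(\<Sum>i | i \<in> {..<k} \<and> mu i = \<mu>. \<Sum>m<d. g (mu i) m * block_comp u i m) =
        (\<Sum>i | i < k \<and> mu i = \<mu>. \<Sum>m<d. g \<mu> m * block_comp u i m)"
      by (intro sum.cong) auto
    also have "\<dots> = (\<Sum>m<d. g \<mu> m * eigencomp u \<mu> m)"
      unfolding eigencomp_eq[OF u] sum_distrib_left by (rule sum.swap)
    finally show "(\<Sum>i | i \<in> {..<k} \<and> mu i = \<mu>. \<Sum>m<d. g (mu i) m * block_comp u i m) =
        (\<Sum>m<d. g \<mu> m * eigencomp u \<mu> m)" .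
  qed
  finally show ?thesis unfolding g_def by (simp add: sum_distrib_left mult.assoc)
qed

section \<open>Torus points as functions of the eigenvalue, and reality\<close>

definition rep :: "complex \<Rightarrow> nat" where "rep \<mu> = (SOME i. i < k \<and> mu i = \<mu>)"

lemma rep: "\<mu> \<in> spec \<Longrightarrow> rep \<mu> < k \<and> mu (rep \<mu>) = \<mu>"
  unfolding rep_def by (rule someI_ex) (auto simp: spec_def)

lemma torus_rep:
  assumes "p \<in> torus k lam" "i < k"
  shows "p $ rep (mu i) = p $ i"
proof (rule torus_eq[OF assms(1) lam _ assms(2)])
  have r: "rep (mu i) < k" "mu (rep (mu i)) = mu i" using rep[of "mu i"] assms(2) by (auto simp: spec_def)
  then show "rep (mu i) < k" "lam (rep (mu i)) = lam i"
    using lam_eq[of "rep (mu i)"] lam_eq[OF assms(2)] by simp_all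
qed

lemma torus_rep_cnj:
  assumes "p \<in> torus k lam" "\<mu> \<in> spec"
  shows "p $ rep (cnj \<mu>) = cnj (p $ rep \<mu>)"
proof (rule torus_cnj[OF assms(1) lam])
  have "cnj \<mu> \<in> spec" using assms(2) cnj_spec by blast
  note r = rep[OF this] rep[OF assms(2)]
  then show "rep (cnj \<mu>) < k" "rep \<mu> < k" by auto
  show "lam (rep (cnj \<mu>)) = cnj (lam (rep \<mu>))"
    using r lam_eq[of "rep (cnj \<mu>)"] lam_eq[of "rep \<mu>"] by simp
qed

lemma P_mult_w_torus:
  assumes "u < d" "p \<in> torus k lam"
  shows "(P *\<^sub>v w (($) p) s) $ u = (\<Sum>\<mu>\<in>spec. complex_of_real (cmod \<mu> powr s) * p $ rep \<mu> *
    (\<Sum>m<d. complex_of_real (s gchoose m) * \<mu> powi (- int m) * eigencomp u \<mu> m))"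
  by (rule P_mult_w_index[OF assms(1)]) (rule torus_rep[OF assms(2)])

lemma P_mult_w_real:
  assumes "u < d" "p \<in> torus k lam"
  shows "Im ((P *\<^sub>v w (($) p) s) $ u) = 0"
proof -
  let ?f = "\<lambda>\<mu>. complex_of_real (cmod \<mu> powr s) * p $ rep \<mu> *
    (\<Sum>m<d. complex_of_real (s gchoose m) * \<mu> powi (- int m) * eigencomp u \<mu> m)"
  have "cnj ((P *\<^sub>v w (($) p) s) $ u) = (\<Sum>\<mu>\<in>spec. ?f (cnj \<mu>))"
    unfolding P_mult_w_torus[OF assms] cnj_sum
    by (intro sum.cong refl) (simp add: torus_rep_cnj assms cnj_eigencomp)
  also have "\<dots> = (\<Sum>\<mu>\<in>cnj ` spec. ?f \<mu>)"
    by (subst sum.reindex) (auto simp: inj_on_def)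
  also have "\<dots> = (P *\<^sub>v w (($) p) s) $ u"
    unfolding cnj_spec P_mult_w_torus[OF assms] ..
  finally show ?thesis by (simp add: complex_eq_iff)
qed

end

lemma exp_mult_ln: "r > 0 \<Longrightarrow> exp (s * ln r) = r powr (s :: real)"
  by (simp add: powr_def)

context jordan_orbit
begin

text \<open>Only the first \<open>k\<close> values of \<open>p\<close> matter, so torus points may
  be plain functions, which suits quantification over valuations.\<close>

lemma w_torus_vec: "w p s = w (($) (vec k p)) s"
  unfolding w_def by (rule cone_vec_cong) simp

section \<open>The invariant set and its definability\<close>

definition inv_set :: "real \<Rightarrow> complex vec set" where
  "inv_set t0 = (\<lambda>y. P *\<^sub>v y) ` trajectory_cone k ds rho lam x' t0 \<union>
     {orbit n |n. real n < log (rho (k - 1)) t0}"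

context
  fixes t0 :: real
  assumes k: "k > 0" and last: "rho (k - 1) > 1" and t0: "t0 \<ge> 1"
begin

lemma mem_inv_set_iff:
  "z \<in> inv_set t0 \<longleftrightarrow>
    (\<exists>p s. vec k p \<in> torus k lam \<and> rho (k - 1) powr s \<ge> t0 \<and> z = P *\<^sub>v w p s) \<or>
    (\<exists>n. real n < log (rho (k - 1)) t0 \<and> z = orbit n)"
proof -
  have "trajectory_cone k ds rho lam x' t0 =
      {w (($) p) s |p s. p \<in> torus k lam \<and> rho (k - 1) powr s \<ge> t0}"
    unfolding w_def by (rule trajectory_cone_eq) (use rho last t0 in auto)
  also have "\<dots> = {w p s |p s. vec k p \<in> torus k lam \<and> rho (k - 1) powr s \<ge> t0}"
  proof -
    have "vec k (($) p) = p" if "p \<in> torus k lam" for p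
      using that by (intro eq_vecI) (auto simp: torus_def)
    then show ?thesis using w_torus_vec by (smt (verit) Collect_cong)
  qed
  finally have eq: "trajectory_cone k ds rho lam x' t0 = \<dots>" .
  show ?thesis unfolding inv_set_def eq by blast
qed

text \<open>The \<open>n\<close>-th orbit point has cone parameter
  \<open>t = rho (k - 1) powr n\<close>, which reaches \<open>t0\<close> exactly when
  \<open>n\<close> is no longer among the listed exponents.\<close>

lemma orbit_mem_inv_set: "orbit n \<in> inv_set t0"
proof (cases "real n < log (rho (k - 1)) t0")
  case True
  then show ?thesis unfolding mem_inv_set_iff by blast
next
  case False
  then have "rho (k - 1) powr log (rho (k - 1)) t0 \<le> rho (k - 1) powr real n"
    using last by (intro powr_mono) auto
  then have "rho (k - 1) powr real n \<ge> t0" using last t0 by simp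
  moreover have "vec k (\<lambda>i. lam i ^ n) \<in> torus k lam" by (rule torus_power[OF lam])
  ultimately show ?thesis unfolding mem_inv_set_iff using orbit_eq[of n] by blast
qed

lemma A_mult_mem_inv_set:
  assumes "z \<in> inv_set t0"
  shows "map_mat of_rat A *\<^sub>v z \<in> inv_set t0"
  using assms unfolding mem_inv_set_iff[of z]
proof (elim disjE exE conjE)
  fix p s assume p: "vec k p \<in> torus k lam" and s: "rho (k - 1) powr s \<ge> t0" and z: "z = P *\<^sub>v w p s"
  have "vec k (\<lambda>i. lam i * vec k p $ i) \<in> torus k lam" by (rule torus_mult[OF p lam])
  also have "vec k (\<lambda>i. lam i * vec k p $ i) = vec k (\<lambda>i. lam i * p i)" by (intro eq_vecI) auto
  finally have "vec k (\<lambda>i. lam i * p i) \<in> torus k lam" .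
  moreover have "rho (k - 1) powr s \<le> rho (k - 1) powr (s + 1)" using last by (intro powr_mono) auto
  then have "rho (k - 1) powr (s + 1) \<ge> t0" using s by linarith
  ultimately show ?thesis unfolding mem_inv_set_iff z A_mult_w by blast
next
  fix n assume "z = orbit n"
  \<comment> \<open>The successor of a listed point may already lie on the cone, so membership of
    the whole orbit is used.\<close>
  then show ?thesis using orbit_mem_inv_set[of "Suc n"] by (simp add: A_mult_orbit)
qed

lemma inv_set_carrier: "z \<in> inv_set t0 \<Longrightarrow> z \<in> carrier_vec d"
  unfolding mem_inv_set_iff
  using P w_carrier A x by (auto simp: orbit_def intro!: mult_mat_vec_carrier[of _ d d])

lemma Im_inv_set:
  assumes "z \<in> inv_set t0" "u < d"
  shows "Im (z $ u) = 0"
  using assms(1) unfolding mem_inv_set_iff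
proof (elim disjE exE conjE)
  fix p s assume "vec k p \<in> torus k lam" "z = P *\<^sub>v w p s"
  then show ?thesis using P_mult_w_real[OF assms(2)] w_torus_vec[of p s] by simp
next
  fix n assume "z = orbit n"
  moreover have "Im (of_rat q) = 0" for q using cnj_of_rat[of q] by (simp add: complex_eq_iff)
  ultimately show ?thesis using orbit_index[OF assms(2)] by simp
qed

text \<open>Variables below \<open>d\<close> are the coordinates and variable \<open>d\<close> is
  \<open>t0\<close>. The last clause confines \<open>R\<close> to these, although auxiliary
  variables above \<open>d\<close> are quantified inside.\<close>

lemma definable_inv_set:
  obtains R where "fo_definable R"
    "\<And>e. e d = t0 \<Longrightarrow> R e \<longleftrightarrow> vec d (\<lambda>u. complex_of_real (e u)) \<in> inv_set t0"
    "\<And>e e'. (\<And>n. n \<in> {..d} \<Longrightarrow> e n = e' n) \<Longrightarrow> R e \<longleftrightarrow> R e'"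
proof -
  obtain V :: "(nat \<Rightarrow> int) set" where V: "finite V"
    "\<And>p. vec k p \<in> torus k lam \<longleftrightarrow>
       (\<forall>i<k. cmod (p i) = 1) \<and> (\<forall>v\<in>V. (\<Prod>i<k. p i powi v i) = 1)"
    using torus_finitely_many_relations[of k lam, OF lam] by metis
  \<comment> \<open>Variable \<open>d + 1\<close> holds \<open>s\<close>; the real and imaginary
    parts of \<open>p\<close> alternate from \<open>d + 2\<close> on.\<close>
  let ?p = "\<lambda>e i. Complex (e (d + 2 + 2 * i)) (e (d + 3 + 2 * i))"
  let ?s = "\<lambda>e. e (d + 1)"
  define pt where "pt p s u = (\<Sum>\<mu>\<in>spec. complex_of_real (exp (s * ln (cmod \<mu>))) * p (rep \<mu>) *
    (\<Sum>m<d. complex_of_real (s gchoose m) * \<mu> powi (- int m) * eigencomp u \<mu> m))"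
    for p :: "nat \<Rightarrow> complex" and s u
  define B where "B e \<longleftrightarrow> (\<forall>i\<in>{..<k}. e (d + 2 + 2 * i) * e (d + 2 + 2 * i) +
        e (d + 3 + 2 * i) * e (d + 3 + 2 * i) = 1) \<and>
      (\<forall>v\<in>V. (\<Prod>i<k. ?p e i powi v i) = 1) \<and> e d \<le> exp (?s e * ln (rho (k - 1))) \<and>
      (\<forall>u\<in>{..<d}. complex_of_real (e u) = pt (?p e) (?s e) u)" for e
  \<comment> \<open>These orbit points are finitely many and rational, so they are listed in the
    formula. The list depends on \<open>t0\<close>, hence \<open>R\<close> is claimed to be correct
    only for \<open>e d = t0\<close>.\<close>
  let ?N = "{n. real n < log (rho (k - 1)) t0}"
  define R where "R e \<longleftrightarrow> (\<exists>a. B (\<lambda>n. if n \<in> {d + 1..} then a n else e n)) \<or>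
      (\<exists>n\<in>?N. \<forall>u\<in>{..<d}. e u = of_rat ((A ^\<^sub>m n *\<^sub>v x) $ u))" for e :: "nat \<Rightarrow> real"
  have fin: "finite ?N"
    by (rule finite_subset[of _ "{..nat \<lceil>log (rho (k - 1)) t0\<rceil>}"]) (auto, linarith)
  have spec_nonzero: "\<mu> \<noteq> 0" if "\<mu> \<in> spec" for \<mu>
    using that mu_nonzero by (auto simp: spec_def)
  then have spec_pos: "cmod \<mu> > 0" if "\<mu> \<in> spec" for \<mu>
    using that by simp
  have pt: "(P *\<^sub>v w p s) $ u = pt p s u" if "u < d" "vec k p \<in> torus k lam" for p s u
  proof -
    have "(P *\<^sub>v w (($) (vec k p)) s) $ u = pt p s u"
      unfolding P_mult_w_torus[OF that] pt_def
      by (intro sum.cong refl) (simp add: rep exp_mult_ln spec_nonzero)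
    then show ?thesis using w_torus_vec[of p s] by simp
  qed
  have rho_last: "fo_fun (\<lambda>_. ln (rho (k - 1)))"
  proof -
    have "mu (k - 1) \<in> spec" using k by (auto simp: spec_def)
    then have "fo_fun (\<lambda>_. cmod (mu (k - 1)))" by (intro fo_fun_const_cmod cfo_fun_spec)
    then show ?thesis using cmod_mu[of "k - 1"] k last by (intro fo_fun_const_ln) auto
  qed
  have "fo_definable B"
    unfolding B_def pt_def
    by (intro fo_definable_conj fo_definable_ball fo_definable_eq fo_definable_ceq fo_definable_le
        fo_fun_add fo_fun_mult fo_fun_var fo_fun_1 cfo_fun_prod cfo_fun_powi cfo_fun_Complex
        cfo_fun_1 fo_fun_exp rho_last cfo_fun_of_real cfo_fun_sum cfo_fun_mult fo_fun_const_ln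
        fo_fun_const_cmod cfo_fun_spec cfo_fun_eigencomp fo_fun_gbinomial V(1) spec_pos finite_lessThan)
      auto
  then have "fo_definable R"
    unfolding R_def
    by (intro fo_definable_disj fo_definable_ex fo_definable_bex fo_definable_ball fo_definable_eq
        fo_fun_var fo_fun_of_rat fin finite_lessThan)
  moreover have "R e \<longleftrightarrow> vec d (\<lambda>u. complex_of_real (e u)) \<in> inv_set t0" if "e d = t0" for e
  proof -
    let ?y = "vec d (\<lambda>u. complex_of_real (e u))"
    have "(\<exists>a. B (\<lambda>n. if n \<in> {d + 1..} then a n else e n)) \<longleftrightarrow>
      (\<exists>p s. vec k p \<in> torus k lam \<and> rho (k - 1) powr s \<ge> t0 \<and> ?y = P *\<^sub>v w p s)"
    proof
      assume "\<exists>a. B (\<lambda>n. if n \<in> {d + 1..} then a n else e n)"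
      then obtain a where a: "B (\<lambda>n. if n \<in> {d + 1..} then a n else e n)" ..
      let ?q = "?p a"
      have q: "vec k ?q \<in> torus k lam"
        unfolding V(2) using a by (auto simp: B_def cmod_def power2_eq_square)
      moreover have "rho (k - 1) powr ?s a \<ge> t0"
        using a last exp_mult_ln[of "rho (k - 1)" "?s a"] by (simp add: B_def that)
      moreover have "?y = P *\<^sub>v w ?q (?s a)"
      proof (rule eq_vecI)
        fix u assume "u < dim_vec (P *\<^sub>v w ?q (?s a))"
        then have u: "u < d" using P by simp
        then show "?y $ u = (P *\<^sub>v w ?q (?s a)) $ u"
          unfolding pt[OF u q] using a by (simp add: B_def)
      qed (use P in simp)
      ultimately show "\<exists>p s. vec k p \<in> torus k lam \<and> rho (k - 1) powr s \<ge> t0 \<and> ?y = P *\<^sub>v w p s"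
        by blast
    next
      assume "\<exists>p s. vec k p \<in> torus k lam \<and> rho (k - 1) powr s \<ge> t0 \<and> ?y = P *\<^sub>v w p s"
      then obtain p s where p: "vec k p \<in> torus k lam" and s: "rho (k - 1) powr s \<ge> t0"
        and y: "?y = P *\<^sub>v w p s" by blast
      \<comment> \<open>The layout is inverted by the parity of \<open>n - d\<close>; the slot of
        \<open>s\<close> also has odd offset and is therefore tested first.\<close>
      define a where "a n = (if n = d + 1 then s else
         if even (n - d) then Re (p ((n - d - 2) div 2)) else Im (p ((n - d - 3) div 2)))" for n
      have a: "?s a = s" "a (d + 2 + 2 * i) = Re (p i)" "a (d + 3 + 2 * i) = Im (p i)" for i
        by (simp_all add: a_def)
      have "complex_of_real (e u) = pt p s u" if "u < d" for u
        using pt[OF that p, of s] that arg_cong[OF y, of "\<lambda>v. v $ u"] by simp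
      moreover have "cmod (p i) = 1" if "i < k" for i using p that unfolding V(2) by blast
      then have "Re (p i) * Re (p i) + Im (p i) * Im (p i) = 1" if "i < k" for i
        using that cmod_power2[of "p i"] by (simp add: power2_eq_square)
      moreover have "t0 \<le> exp (s * ln (rho (k - 1)))"
        using s last exp_mult_ln[of "rho (k - 1)" s] by simp
      ultimately have "B (\<lambda>n. if n \<in> {d + 1..} then a n else e n)"
        using p \<open>e d = t0\<close> a unfolding B_def V(2) by simp
      then show "\<exists>a. B (\<lambda>n. if n \<in> {d + 1..} then a n else e n)" by (rule exI[of _ a])
    qed
    moreover have "(\<exists>n\<in>?N. \<forall>u\<in>{..<d}. e u = of_rat ((A ^\<^sub>m n *\<^sub>v x) $ u)) \<longleftrightarrow>
        (\<exists>n. real n < log (rho (k - 1)) t0 \<and> ?y = orbit n)"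
    proof -
      have "(\<forall>u\<in>{..<d}. e u = of_rat ((A ^\<^sub>m n *\<^sub>v x) $ u)) \<longleftrightarrow> ?y = orbit n" for n
      proof -
        have "dim_vec (orbit n) = d" unfolding orbit_def using A by simp
        then have "?y = orbit n \<longleftrightarrow> (\<forall>u<d. complex_of_real (e u) = of_rat ((A ^\<^sub>m n *\<^sub>v x) $ u))"
          by (auto simp: vec_eq_iff orbit_index)
        also have "\<dots> \<longleftrightarrow> (\<forall>u\<in>{..<d}. e u = of_rat ((A ^\<^sub>m n *\<^sub>v x) $ u))"
        proof -
          have "complex_of_real r = of_rat q \<longleftrightarrow> r = of_rat q" for r q
            using of_real_eq_iff[of r "of_rat q", where 'a = complex] unfolding of_real_of_rat .
          then show ?thesis by auto
        qed
        finally show ?thesis by blast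
      qed
      then show ?thesis by simp
    qed
    ultimately show ?thesis unfolding R_def mem_inv_set_iff by blast
  qed
  moreover have "R e \<longleftrightarrow> R e'" if "\<And>n. n \<in> {..d} \<Longrightarrow> e n = e' n" for e e'
  proof -
    have "(\<lambda>n. if n \<in> {d + 1..} then a n else e n) = (\<lambda>n. if n \<in> {d + 1..} then a n else e' n)" for a
      using that by auto
    moreover have "e u = e' u" if "u \<in> {..<d}" for u
      using \<open>\<And>n. n \<in> {..d} \<Longrightarrow> e n = e' n\<close> that by simp
    ultimately show ?thesis unfolding R_def by simp
  qed
  ultimately show ?thesis by (rule that)
qed

end

end

theorem theorem1:
  fixes d k :: nat
    and A :: "rat mat" and x :: "rat vec"
    and P Pinv :: "complex mat"
    and ds :: "nat \<Rightarrow> nat" and rho :: "nat \<Rightarrow> real" and lam :: "nat \<Rightarrow> complex"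
    and t0 :: real
  assumes A: "A \<in> carrier_mat d d" "invertible_mat A"
    and x: "x \<in> carrier_vec d"
    and k: "k > 0"
    and blocks: "\<And>i. i < k \<Longrightarrow> ds i > 0"
      "\<And>i. i < k \<Longrightarrow> rho i > 0"
      "\<And>i. i < k \<Longrightarrow> cmod (lam i) = 1"
    and jordan: "similar_mat_wit (map_mat of_rat A) (jordan_form k ds rho lam) P Pinv"
    and rho_last: "rho (k - 1) > 1"
    and t0: "t0 \<ge> 1"
  shows "\<exists>I :: real vec set. I \<subseteq> carrier_vec d \<and>
    map_vec complex_of_real ` I =
      (\<lambda>y. P *\<^sub>v y) ` trajectory_cone k ds rho lam (Pinv *\<^sub>v map_vec of_rat x) t0 \<union>
      {map_vec of_rat (A ^\<^sub>m n *\<^sub>v x) |n. real n < log (rho (k - 1)) t0} \<and>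
    Rexp_definable {t0} d I \<and>
    is_invariant (map_mat of_rat A) (map_vec of_rat x) I"
proof -
  interpret jordan_orbit d k A x P Pinv ds rho lam
    by unfold_locales (use assms in auto)
  let ?S = "inv_set t0"
  \<comment> \<open>The real points of the complex set; as all entries of the latter are real,
    complexification maps \<open>I\<close> onto it.\<close>
  define I where "I = {y \<in> carrier_vec d. map_vec complex_of_real y \<in> ?S}"
  have S: "?S = (\<lambda>y. P *\<^sub>v y) ` trajectory_cone k ds rho lam (Pinv *\<^sub>v map_vec of_rat x) t0 \<union>
      {map_vec of_rat (A ^\<^sub>m n *\<^sub>v x) |n. real n < log (rho (k - 1)) t0}"
    unfolding inv_set_def x'_def orbit_def ..
  have "z \<in> map_vec complex_of_real ` I" if "z \<in> ?S" for z
  proof -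
    have "z = map_vec complex_of_real (map_vec Re z)"
      using Im_inv_set[OF k rho_last t0 that] inv_set_carrier[OF k rho_last t0 that]
      by (intro eq_vecI) (auto simp: complex_eq_iff)
    moreover have "map_vec Re z \<in> carrier_vec d"
      using inv_set_carrier[OF k rho_last t0 that] by simp
    ultimately show ?thesis using that unfolding I_def by (intro image_eqI[of _ _ "map_vec Re z"]) auto
  qed
  then have image: "map_vec complex_of_real ` I = ?S" unfolding I_def by auto
  have "map_vec complex_of_real (map_vec of_rat x) = orbit 0"
    unfolding orbit_def using A x by (intro eq_vecI) (simp_all add: of_real_of_rat)
  then have "map_vec of_rat x \<in> I"
    unfolding I_def using x orbit_mem_inv_set[OF k rho_last t0] by simp
  moreover have "map_mat of_rat A *\<^sub>v y \<in> I" if "y \<in> I" for y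
  proof -
    have y: "y \<in> carrier_vec d" "map_vec complex_of_real y \<in> ?S" using that unfolding I_def by auto
    have "map_mat complex_of_real (map_mat of_rat A) = map_mat of_rat A"
      by (intro eq_matI) (simp_all add: of_real_of_rat)
    moreover have "map_vec complex_of_real (map_mat of_rat A *\<^sub>v y) =
        map_mat complex_of_real (map_mat of_rat A) *\<^sub>v map_vec complex_of_real y"
      using A(1) y(1) by (intro of_real_hom.mult_mat_vec_hom[of _ d d]) auto
    ultimately have "map_vec complex_of_real (map_mat of_rat A *\<^sub>v y) =
        map_mat of_rat A *\<^sub>v map_vec complex_of_real y" by simp
    then show ?thesis
      unfolding I_def using A_mult_mem_inv_set[OF k rho_last t0 y(2)] A(1) y(1) by simp
  qed
  ultimately have inv: "is_invariant (map_mat of_rat A) (map_vec of_rat x) I"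
    unfolding is_invariant_def by blast
  obtain R where R: "fo_definable R"
    "\<And>e. e d = t0 \<Longrightarrow> R e \<longleftrightarrow> vec d (\<lambda>u. complex_of_real (e u)) \<in> ?S"
    "\<And>e e'. (\<And>n. n \<in> {..d} \<Longrightarrow> e n = e' n) \<Longrightarrow> R e \<longleftrightarrow> R e'"
    by (rule definable_inv_set[OF k rho_last t0]) blast
  obtain f where f: "free_vars f \<subseteq> {..d}" "\<And>e. holds e f \<longleftrightarrow> R e"
    using fo_definable_restrict_vars[of R "{..d}", OF R(1,3)] by blast
  have "map_vec complex_of_real y \<in> ?S \<longleftrightarrow> holds (\<lambda>n. if n < d then y $ n else [t0] ! (n - d)) f"
    if "y \<in> carrier_vec d" for y
  proof -
    have "vec d (\<lambda>u. complex_of_real (if u < d then y $ u else [t0] ! (u - d))) = map_vec complex_of_real y"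
      using that by (intro eq_vecI) auto
    then show ?thesis unfolding f(2) by (subst R(2)) simp_all
  qed
  then have "I = {y \<in> carrier_vec d. holds (\<lambda>n. if n < d then y $ n else [t0] ! (n - d)) f}"
    unfolding I_def by blast
  moreover have "{..d} = {..<d + length [t0]}" by auto
  ultimately have "Rexp_definable {t0} d I"
    unfolding Rexp_definable_def using f(1) by (intro exI[of _ f] exI[of _ "[t0]"]) simp
  moreover have "I \<subseteq> carrier_vec d" unfolding I_def by blast
  ultimately show ?thesis using image inv unfolding S by (intro exI[of _ I] conjI)
qed

end
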